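(* For every $p$ with $1<p<\infty$ there are continuum many closed ideals in $\mathcal{L}(\ell_p,\ell_\infty)$ and there are continuum many closed ideals in $\mathcal{L}(\ell_1,\ell_p)$.
   Context: Banach spaces are over the real scalars; an operator is a bounded linear map. $\mathcal{L}(X,Y)$ is the space of all operators from $X$ to $Y$ with the operator norm, and $\mathcal{L}(X)=\mathcal{L}(X,X)$. An (operator) ideal of $\mathcal{L}(X,Y)$ is a linear subspace $\mathcal{J}$ of $\mathcal{L}(X,Y)$ such that $ATB\in\mathcal{J}$ whenever $A\in\mathcal{L}(Y)$, $T\in\mathcal{J}$, $B\in\mathcal{L}(X)$. A closed ideal is an ideal that is closed in the operator norm. "There are continuum many closed ideals" means that there is a family of pairwise distinct closed ideals of cardinality $2^{\aleph_0}$. *)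

theory Defs
  imports
    "HOL-Analysis.Analysis"
    "HOL-Library.Equipollence"
    "HOL-Library.FuncSet"
begin

text \<open>
  The exponent of \<open>\<ell>\<^sub>p\<close> is a variable of the theory, so the spaces cannot be types.  A normed space
  of real sequences is given by its set of vectors and its norm; the linear structure is always the
  pointwise one.
\<close>

record seqspace =
  vecs :: "(nat \<Rightarrow> real) set"
  nrm :: "(nat \<Rightarrow> real) \<Rightarrow> real"

definition ell :: "real \<Rightarrow> seqspace" where
  "ell p = \<lparr> vecs = {x. summable (\<lambda>n. \<bar>x n\<bar> powr p)},
             nrm = (\<lambda>x. (\<Sum>n. \<bar>x n\<bar> powr p) powr (1 / p)) \<rparr>"

definition ell_infinity :: seqspace where
  "ell_infinity = \<lparr> vecs = {x. bounded (range x)},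
                    nrm = (\<lambda>x. SUP n. \<bar>x n\<bar>) \<rparr>"

text \<open>
  Operators are \<open>undefined\<close> outside the domain (they lie in \<^term>\<open>vecs X \<rightarrow>\<^sub>E vecs Y\<close>), so that equality
  of functions is equality of operators.  The vector space operations and the composition below
  accordingly restrict their results to the domain.
\<close>

definition operators :: "seqspace \<Rightarrow> seqspace \<Rightarrow> ((nat \<Rightarrow> real) \<Rightarrow> (nat \<Rightarrow> real)) set" where
  "operators X Y = {T \<in> vecs X \<rightarrow>\<^sub>E vecs Y.
     (\<forall>x \<in> vecs X. \<forall>y \<in> vecs X. T (\<lambda>n. x n + y n) = (\<lambda>n. T x n + T y n)) \<and>
     (\<forall>c. \<forall>x \<in> vecs X. T (\<lambda>n. c * x n) = (\<lambda>n. c * T x n)) \<and>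
     (\<exists>C. \<forall>x \<in> vecs X. nrm Y (T x) \<le> C * nrm X x)}"

definition opnorm :: "seqspace \<Rightarrow> seqspace \<Rightarrow> ((nat \<Rightarrow> real) \<Rightarrow> (nat \<Rightarrow> real)) \<Rightarrow> real" where
  "opnorm X Y T = (SUP x \<in> {x \<in> vecs X. nrm X x \<le> 1}. nrm Y (T x))"

definition op_zero :: "seqspace \<Rightarrow> (nat \<Rightarrow> real) \<Rightarrow> (nat \<Rightarrow> real)" where
  "op_zero X = (\<lambda>x \<in> vecs X. \<lambda>n. 0)"

definition op_add :: "seqspace \<Rightarrow> ((nat \<Rightarrow> real) \<Rightarrow> (nat \<Rightarrow> real)) \<Rightarrow>
    ((nat \<Rightarrow> real) \<Rightarrow> (nat \<Rightarrow> real)) \<Rightarrow> (nat \<Rightarrow> real) \<Rightarrow> (nat \<Rightarrow> real)" where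
  "op_add X S T = (\<lambda>x \<in> vecs X. \<lambda>n. S x n + T x n)"

definition op_scale :: "seqspace \<Rightarrow> real \<Rightarrow>
    ((nat \<Rightarrow> real) \<Rightarrow> (nat \<Rightarrow> real)) \<Rightarrow> (nat \<Rightarrow> real) \<Rightarrow> (nat \<Rightarrow> real)" where
  "op_scale X c T = (\<lambda>x \<in> vecs X. \<lambda>n. c * T x n)"

definition op_diff :: "seqspace \<Rightarrow> ((nat \<Rightarrow> real) \<Rightarrow> (nat \<Rightarrow> real)) \<Rightarrow>
    ((nat \<Rightarrow> real) \<Rightarrow> (nat \<Rightarrow> real)) \<Rightarrow> (nat \<Rightarrow> real) \<Rightarrow> (nat \<Rightarrow> real)" where
  "op_diff X S T = (\<lambda>x \<in> vecs X. \<lambda>n. S x n - T x n)"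

definition operator_ideal ::
    "seqspace \<Rightarrow> seqspace \<Rightarrow> ((nat \<Rightarrow> real) \<Rightarrow> (nat \<Rightarrow> real)) set \<Rightarrow> bool" where
  "operator_ideal X Y J \<longleftrightarrow>
     J \<subseteq> operators X Y \<and>
     op_zero X \<in> J \<and>
     (\<forall>S \<in> J. \<forall>T \<in> J. op_add X S T \<in> J) \<and>
     (\<forall>c. \<forall>T \<in> J. op_scale X c T \<in> J) \<and>
     (\<forall>A \<in> operators Y Y. \<forall>T \<in> J. \<forall>B \<in> operators X X. restrict (A \<circ> T \<circ> B) (vecs X) \<in> J)"

definition closed_operator_ideal ::
    "seqspace \<Rightarrow> seqspace \<Rightarrow> ((nat \<Rightarrow> real) \<Rightarrow> (nat \<Rightarrow> real)) set \<Rightarrow> bool" where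
  "closed_operator_ideal X Y J \<longleftrightarrow>
     operator_ideal X Y J \<and>
     (\<forall>S T. (\<forall>k. S k \<in> J) \<and> T \<in> operators X Y \<and>
            (\<lambda>k. opnorm X Y (op_diff X (S k) T)) \<longlonglongrightarrow> 0 \<longrightarrow> T \<in> J)"

definition continuum_many_closed_ideals :: "seqspace \<Rightarrow> seqspace \<Rightarrow> bool" where
  "continuum_many_closed_ideals X Y \<longleftrightarrow>
     (\<exists>F. F \<subseteq> {J. closed_operator_ideal X Y J} \<and> F \<approx> (UNIV :: real set))"

end

theory Submission
  imports Defs "HOL-Real_Asymp.Real_Asymp"
begin

text \<open>
  On level \<open>n\<close> there are \<open>N\<^sub>n\<close> lines of length \<open>L\<^sub>n\<close> in a finite grid, any two meeting in at most
  one point, with \<open>N\<^sub>n\<close> superpolynomial in \<open>L\<^sub>n\<close> and \<open>L\<^sub>n\<^sub>+\<^sub>1\<close> enormous compared with \<open>N\<^sub>n\<close>.  Normalising the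
  indicator of a line \<open>t\<close> gives a unit vector \<open>x\<^sub>t\<close> of \<open>\<ell>\<^sub>p\<close> and a norm-one functional \<open>f\<^sub>t\<close> with
  \<open>f\<^sub>t(x\<^sub>t) = 1\<close>.  For a set \<open>M\<close> of levels, consider the operator \<open>\<ell>\<^sub>p \<rightarrow> \<ell>\<^sub>\<infinity>\<close> with coordinates \<open>f\<^sub>t\<close>, the
  operator \<open>\<ell>\<^sub>1 \<rightarrow> \<ell>\<^sub>p\<close> with columns \<open>x\<^sub>t\<close>, where \<open>t\<close> ranges over the levels in \<open>M\<close>, and closed ideals that
  they belong to.

  If the operator of \<open>M\<close> lay in the ideal of \<open>M'\<close>, then for each \<open>n \<in> M - M'\<close> and each line \<open>t\<close> of
  level \<open>n\<close> one of finitely many fixed operators \<open>B\<close> and a line \<open>t'\<close> of another level would satisfy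
  \<open>\<bar>f\<^sub>t\<^sub>'(B x\<^sub>t)\<bar> \<ge> c\<close> (respectively \<open>\<bar>f\<^sub>t(B x\<^sub>t\<^sub>')\<bar> \<ge> c\<close>).  A fixed \<open>t'\<close> serves boundedly many \<open>t\<close>, because a
  bounded functional cannot be large on many nearly disjoint unit vectors of \<open>\<ell>\<^sub>p\<close>.  There are few
  \<open>t'\<close> on the levels below \<open>n\<close>.  A \<open>t'\<close> on a level above \<open>n\<close> is large on \<open>B e\<^sub>i\<close> for some point \<open>i\<close> of
  the grid, and by the same argument each \<open>i\<close> admits only polynomially many such \<open>t'\<close>.  So \<open>N\<^sub>n\<close>
  is bounded by a power of \<open>L\<^sub>n\<close>, which fails for large \<open>n\<close>.  Hence almost disjoint sets of levels
  give distinct ideals.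
\<close>

section \<open>Nearly disjoint lines\<close>

definition lpn :: "real \<Rightarrow> nat set \<Rightarrow> (nat \<Rightarrow> real) \<Rightarrow> real" where
  "lpn a E x = (\<Sum>i\<in>E. \<bar>x i\<bar> powr a) powr (1 / a)"

text \<open>
  A triple \<open>(n, u, v)\<close> stands for the line \<open>w = u * a + v\<close> over the abscissae \<open>a < side n\<close>.  The points
  of all levels are coded as natural numbers, so that a line is a set of coordinates.  The number
  of slopes grows faster than every power of \<open>side n\<close>, and each side is much larger than
  everything that lives on the previous levels.
\<close>

fun side :: "nat \<Rightarrow> nat" where
  "side 0 = 2"
| "side (Suc n) = (n + 2) * (side n ^ n)\<^sup>2 * side n"

definition slopes :: "nat \<Rightarrow> nat" where
  "slopes n = side n ^ n"

definition lines :: "nat \<Rightarrow> (nat \<times> nat \<times> nat) set" where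
  "lines n = {n} \<times> {..<slopes n} \<times> {..<slopes n}"

text \<open>The level is part of the code of every point, so lines of different levels are
  disjoint.\<close>

definition line :: "nat \<times> nat \<times> nat \<Rightarrow> nat set" where
  "line = (\<lambda>(n, u, v). (\<lambda>a. prod_encode (n, prod_encode (a, u * a + v))) ` {..<side n})"

definition grid :: "nat \<Rightarrow> nat set" where
  "grid n = (\<lambda>(a, w). prod_encode (n, prod_encode (a, w))) ` ({..<side n} \<times> {..<slopes n * side n})"

section \<open>Growth of the sides, and counts of lines and points\<close>

lemma side_Suc: "side (Suc n) = (n + 2) * (slopes n)\<^sup>2 * side n"
  by (simp add: slopes_def)

lemma side_pos: "0 < side n"
  by (induction n) auto

lemma slopes_pos: "0 < slopes n"
  by (simp add: slopes_def side_pos)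

lemma side_Suc_ge: "(n + 2) * side n \<le> side (Suc n)"
proof -
  have "1 \<le> (slopes n)\<^sup>2" using slopes_pos[of n] by simp
  then have "(n + 2) * 1 * side n \<le> (n + 2) * (slopes n)\<^sup>2 * side n"
    by (intro mult_le_mono) auto
  then show ?thesis by (simp only: side_Suc)
qed

lemma side_mono: "m \<le> n \<Longrightarrow> side m \<le> side n"
proof (induction n rule: dec_induct)
  case (step n)
  have "side n \<le> (n + 2) * side n" by simp
  with side_Suc_ge[of n] step show ?case by linarith
qed simp

lemma side_gt: "n < side n"
proof (induction n)
  case (Suc n)
  have "(n + 2) * 1 \<le> (n + 2) * side n" using side_pos[of n] by (intro mult_le_mono) auto
  also note side_Suc_ge[of n]
  finally show ?case by simp
qed simp

text \<open>Feeds \<open>far_bound\<close>: a line above level \<open>n\<close> stays long even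
  against as many intersections as there are lines of level \<open>n\<close>. The factor
  \<open>side n\<close> compensates for the decaying threshold there, and the factor
  \<open>n\<close> absorbs constants.\<close>

lemma side_gap: "n < m \<Longrightarrow> n * (slopes n)\<^sup>2 * side n \<le> side m"
proof -
  assume "n < m"
  then have "side (Suc n) \<le> side m" by (intro side_mono) auto
  moreover have "n * (slopes n)\<^sup>2 * side n \<le> side (Suc n)"
    unfolding side_Suc by (intro mult_le_mono) auto
  ultimately show ?thesis by linarith
qed

lemma finite_lines: "finite (lines n)"
  by (simp add: lines_def)

lemma card_lines: "card (lines n) = (slopes n)\<^sup>2"
  by (simp add: lines_def power2_eq_square)

lemma fst_lines: "t \<in> lines n \<Longrightarrow> fst t = n"
  by (auto simp: lines_def)

text \<open>The induction closes because a new level adds \<open>(slopes n)\<^sup>2\<close> lines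
  and even twice \<open>(slopes n)\<^sup>2 * side n\<close> fits into \<open>side (Suc n)\<close>,
  by \<open>n + 2 \<ge> 2\<close>.\<close>

lemma card_lines_below: "card (\<Union>m<n. lines m) \<le> side n"
proof (induction n)
  case (Suc n)
  have *: "(\<Union>m<Suc n. lines m) = (\<Union>m<n. lines m) \<union> lines n"
    by (auto simp: less_Suc_eq)
  have "card (\<Union>m<Suc n. lines m) \<le> card (\<Union>m<n. lines m) + card (lines n)"
    unfolding * by (rule card_Un_le)
  also have "\<dots> \<le> side n + (slopes n)\<^sup>2" using Suc by (simp add: card_lines)
  also have "side n \<le> (slopes n)\<^sup>2 * side n" using slopes_pos[of n] by simp
  also have "(slopes n)\<^sup>2 * side n + (slopes n)\<^sup>2 \<le> (slopes n)\<^sup>2 * side n + (slopes n)\<^sup>2 * side n"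
    using side_pos[of n] by simp
  also have "\<dots> = 2 * (slopes n)\<^sup>2 * side n" by simp
  also have "\<dots> \<le> side (Suc n)" unfolding side_Suc by (intro mult_le_mono) auto
  finally show ?case by simp
qed simp

lemma finite_line: "finite (line t)"
  by (cases t) (simp add: line_def)

lemma card_line: "card (line t) = side (fst t)"
  by (cases t) (auto simp: line_def card_image inj_on_def)

text \<open>Two common points satisfy \<open>(u - u') * (a - b) = 0\<close>, and equal slopes with a
  common point would force equal intercepts, so the abscissae agree. Across levels there is no
  common point at all.\<close>

lemma card_line_Int:
  assumes "t \<noteq> t'"
  shows "card (line t \<inter> line t') \<le> 1"
proof -
  obtain n u v where t: "t = (n, u, v)" by (cases t)
  obtain n' u' v' where t': "t' = (n', u', v')" by (cases t')
  have "x = y" if "x \<in> line t \<inter> line t'" "y \<in> line t \<inter> line t'" for x y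
  proof -
    from that(1) obtain a where a: "x = prod_encode (n, prod_encode (a, u * a + v))"
      "n = n'" "u * a + v = u' * a + v'"
      by (auto simp: t t' line_def)
    from that(2) obtain b where b: "y = prod_encode (n, prod_encode (b, u * b + v))"
      "u * b + v = u' * b + v'"
      by (auto simp: t t' line_def)
    have "int u * int a + int v = int u' * int a + int v'"
      "int u * int b + int v = int u' * int b + int v'"
      using a(3) b(2) by (metis of_nat_add of_nat_mult)+
    then have "(int u - int u') * (int a - int b) = 0" by (simp add: algebra_simps)
    moreover have "u \<noteq> u'"
      using a(2,3) assms by (auto simp: t t')
    ultimately have "a = b" by auto
    with a b show "x = y" by simp
  qed
  then show ?thesis
    by (metis card_le_Suc0_iff_eq finite_Int finite_line One_nat_def)
qed

lemma line_subset_grid: "t \<in> lines n \<Longrightarrow> line t \<subseteq> grid n"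
proof
  fix x assume t: "t \<in> lines n" and x: "x \<in> line t"
  obtain u v where uv: "t = (n, u, v)" "u < slopes n" "v < slopes n"
    using t by (auto simp: lines_def)
  obtain a where a: "a < side n" "x = prod_encode (n, prod_encode (a, u * a + v))"
    using x by (auto simp: uv line_def)
  have "u * a + v < u * a + slopes n" using uv by simp
  also have "\<dots> \<le> slopes n * a + slopes n" using uv by simp
  also have "\<dots> = slopes n * Suc a" by simp
  also have "\<dots> \<le> slopes n * side n" using a by (intro mult_le_mono) auto
  finally show "x \<in> grid n" using a by (force simp: grid_def)
qed

lemma finite_grid: "finite (grid n)"
  by (simp add: grid_def)

text \<open>Only one factor \<open>slopes n\<close>, against \<open>(slopes n)\<^sup>2\<close> lines
  on the level: the final contradiction lives on this missing factor.\<close>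

lemma card_grid: "card (grid n) \<le> slopes n * (side n)\<^sup>2"
proof -
  have "card (grid n) \<le> card ({..<side n} \<times> {..<slopes n * side n})"
    unfolding grid_def by (intro card_image_le) auto
  then show ?thesis by (simp add: power2_eq_square mult_ac)
qed

lemma powr_neg_root_powr: "0 < s \<Longrightarrow> 0 < b \<Longrightarrow> (s powr (- (1 / b))) powr b = 1 / (s :: real)"
  using powr_minus_divide[of s 1] by (simp add: powr_powr)

text \<open>
  Distinct lines meet in at most one point, so few long lines are disjoint up to small parts, and a
  functional that is large on all of them is large on a combination of disjointly supported vectors.
\<close>

lemma few_large_values:
  fixes G \<gamma> :: real
  assumes a: "0 < a"
    and h: "\<And>E x. finite E \<Longrightarrow> \<bar>\<Sum>i\<in>E. h i * x i\<bar> \<le> G * lpn a E x"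
    and R: "finite R" and G: "0 \<le> G"
    and large: "\<And>t. t \<in> R \<Longrightarrow> \<gamma> * side (fst t) powr (1 / a) \<le> \<bar>\<Sum>i\<in>line t. h i\<bar>"
    and small: "\<And>t. t \<in> R \<Longrightarrow> 2 * G * card R powr (1 / a) \<le> \<gamma> * side (fst t) powr (1 / a)"
  shows "card R * \<gamma> \<le> 2 * G * card R powr (1 / a)"
proof -
  \<comment> \<open>Only the points of \<open>t\<close> on other lines of \<open>R\<close> obstruct
    disjointness, and there are at most \<open>card R\<close> of them.\<close>
  define near where "near t = (\<Union>t'\<in>R - {t}. line t \<inter> line t')" for t
  define priv where "priv t = line t - near t" for t
  have near_sub: "near t \<subseteq> line t" for t by (auto simp: near_def)
  have fin: "finite (near t)" "finite (priv t)" for t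
    using finite_subset[OF near_sub finite_line] finite_line[of t] by (auto simp: priv_def)
  have card_near: "card (near t) \<le> card R" for t
  proof -
    have "card (near t) \<le> (\<Sum>t'\<in>R - {t}. card (line t \<inter> line t'))"
      unfolding near_def using R by (intro card_UN_le) auto
    also have "\<dots> \<le> (\<Sum>t'\<in>R - {t}. 1)"
      by (intro sum_mono card_line_Int) auto
    also have "\<dots> \<le> card R" using R by (simp add: card_Diff1_le)
    finally show ?thesis .
  qed
  have disj: "priv t \<inter> priv t' = {}" if "t \<in> R" "t' \<in> R" "t \<noteq> t'" for t t'
    using that by (auto simp: priv_def near_def)
  \<comment> \<open>By \<open>small\<close>, the points in \<open>near t\<close> carry at most half
    of the lower bound, so the private points keep the other half.\<close>
  have privlarge: "\<gamma> / 2 * side (fst t) powr (1 / a) \<le> \<bar>\<Sum>i\<in>priv t. h i\<bar>" if t: "t \<in> R" for t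
  proof -
    have "\<bar>\<Sum>i\<in>near t. h i\<bar> \<le> G * lpn a (near t) (\<lambda>_. 1)"
      using h[OF fin(1), of "\<lambda>_. 1" t] by simp
    also have "\<dots> = G * real (card (near t)) powr (1 / a)"
      by (simp add: lpn_def)
    also have "\<dots> \<le> G * real (card R) powr (1 / a)"
      using a card_near[of t] G by (intro mult_left_mono powr_mono2) auto
    also have "\<dots> \<le> \<gamma> / 2 * side (fst t) powr (1 / a)" using small[OF t] by simp
    finally have 1: "\<bar>\<Sum>i\<in>near t. h i\<bar> \<le> \<gamma> / 2 * side (fst t) powr (1 / a)" .
    have "(\<Sum>i\<in>line t. h i) = (\<Sum>i\<in>priv t. h i) + (\<Sum>i\<in>near t. h i)"
      unfolding priv_def by (rule sum.subset_diff[OF near_sub finite_line])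
    with 1 large[OF t] show ?thesis by (simp add: field_simps)
  qed
  \<comment> \<open>The test vector is constant on each private part: the weight \<open>w t\<close>
    makes every block of norm at most one, and the sign makes every block contribute nonnegatively.
    The choice by \<open>SOME\<close> is unambiguous because the private parts are disjoint.\<close>
  define w where "w t = side (fst t) powr (- (1 / a))" for t :: "nat \<times> nat \<times> nat"
  define \<sigma> where "\<sigma> t = sgn (\<Sum>i\<in>priv t. h i) * w t" for t
  define x where "x i = \<sigma> (SOME t. t \<in> R \<and> i \<in> priv t)" for i
  define E where "E = (\<Union>t\<in>R. priv t)"
  have finE: "finite E" using R fin by (auto simp: E_def)
  have x: "x i = \<sigma> t" if "t \<in> R" "i \<in> priv t" for i t
  proof -
    have "(SOME t. t \<in> R \<and> i \<in> priv t) = t"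
      using that disj by (intro some_equality) blast+
    then show ?thesis by (simp add: x_def)
  qed
  have sumE: "(\<Sum>i\<in>E. f i) = (\<Sum>t\<in>R. \<Sum>i\<in>priv t. f i)" for f :: "nat \<Rightarrow> real"
    unfolding E_def using R fin disj by (intro sum.UNION_disjoint) auto
  have spos: "0 < real (side (fst t))" for t :: "nat \<times> nat \<times> nat" using side_pos by simp
  have "card R * (\<gamma> / 2) = (\<Sum>t\<in>R. \<gamma> / 2)" by simp
  also have "\<dots> \<le> (\<Sum>t\<in>R. \<Sum>i\<in>priv t. h i * x i)"
  proof (rule sum_mono)
    fix t assume t: "t \<in> R"
    have "(\<Sum>i\<in>priv t. h i * x i) = (\<Sum>i\<in>priv t. h i) * \<sigma> t"
      using x[OF t] by (simp add: sum_distrib_right)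
    also have "\<dots> = \<bar>\<Sum>i\<in>priv t. h i\<bar> * w t"
      by (simp add: \<sigma>_def abs_sgn)
    also have "\<dots> \<ge> \<gamma> / 2 * side (fst t) powr (1 / a) * w t"
      using privlarge[OF t] by (intro mult_right_mono) (auto simp: w_def)
    also have "\<gamma> / 2 * side (fst t) powr (1 / a) * w t = \<gamma> / 2"
      using spos[of t] by (simp add: w_def flip: powr_add)
    finally show "\<gamma> / 2 \<le> (\<Sum>i\<in>priv t. h i * x i)" by simp
  qed
  also have "\<dots> = (\<Sum>i\<in>E. h i * x i)" by (simp add: sumE)
  also have "\<dots> \<le> G * lpn a E x" using h[OF finE, of x] by simp
  \<comment> \<open>The blocks have disjoint supports, so their \<open>a\<close>-th powers add up:
    \<open>card R\<close> blocks of norm at most one.\<close>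
  also have "lpn a E x \<le> card R powr (1 / a)"
    unfolding lpn_def
  proof (intro powr_mono2)
    have "(\<Sum>i\<in>E. \<bar>x i\<bar> powr a) = (\<Sum>t\<in>R. \<Sum>i\<in>priv t. \<bar>\<sigma> t\<bar> powr a)"
      unfolding sumE using x by (intro sum.cong) auto
    also have "\<dots> \<le> (\<Sum>t\<in>R. 1)"
    proof (rule sum_mono)
      fix t assume "t \<in> R"
      have "\<bar>\<sigma> t\<bar> powr a \<le> w t powr a"
        using a by (intro powr_mono2) (auto simp: \<sigma>_def abs_mult w_def abs_sgn_eq)
      also have "\<dots> = 1 / side (fst t)"
        using a spos[of t] by (simp add: w_def powr_neg_root_powr)
      finally have 1: "\<bar>\<sigma> t\<bar> powr a \<le> 1 / side (fst t)" .
      have "card (priv t) \<le> card (line t)"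
        by (intro card_mono finite_line) (auto simp: priv_def)
      then have "real (card (priv t)) \<le> side (fst t)" by (simp add: card_line)
      then have "card (priv t) * \<bar>\<sigma> t\<bar> powr a \<le> side (fst t) * (1 / side (fst t))"
        using 1 by (intro mult_mono) auto
      then show "(\<Sum>i\<in>priv t. \<bar>\<sigma> t\<bar> powr a) \<le> 1" using spos[of t] by simp
    qed
    finally show "(\<Sum>i\<in>E. \<bar>x i\<bar> powr a) \<le> card R" by simp
  qed (use a in \<open>auto intro: sum_nonneg\<close>)
  finally show ?thesis using G by (simp add: mult_left_mono)
qed

section \<open>The counting argument\<close>

text \<open>A bounded bilinear form on \<open>ell a\<close> times \<open>ell b\<close>, given by its
  matrix and tested on finite sections, so that no convergence is involved.\<close>

definition form_bound :: "real \<Rightarrow> real \<Rightarrow> real \<Rightarrow> (nat \<Rightarrow> nat \<Rightarrow> real) \<Rightarrow> bool" where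
  "form_bound a b C \<beta> \<longleftrightarrow> (\<forall>E F x y. finite E \<longrightarrow> finite F \<longrightarrow>
     \<bar>\<Sum>i\<in>E. \<Sum>j\<in>F. \<beta> i j * x i * y j\<bar> \<le> C * lpn a E x * lpn b F y)"

lemma form_boundD:
  "form_bound a b C \<beta> \<Longrightarrow> finite E \<Longrightarrow> finite F \<Longrightarrow>
     \<bar>\<Sum>i\<in>E. \<Sum>j\<in>F. \<beta> i j * x i * y j\<bar> \<le> C * lpn a E x * lpn b F y"
  by (auto simp: form_bound_def)

lemma lpn_line: "0 < b \<Longrightarrow> lpn b (line t) (\<lambda>_. side (fst t) powr (- (1 / b))) = 1"
  using side_pos[of "fst t"]
  by (simp add: lpn_def card_line powr_neg_root_powr)

text \<open>If there were \<open>r\<close> lines, \<open>few_large_values\<close> applied to exactly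
  \<open>r\<close> of them would contradict the first condition on \<open>r\<close>; the second one
  is its smallness hypothesis. Passing to exactly \<open>r\<close> lines frees both conditions from
  the unknown \<open>card R\<close>.\<close>

lemma fibre_bound:
  fixes c C :: real and r :: nat
  assumes a: "0 < a" and C: "0 \<le> C"
    and h: "\<And>E x. finite E \<Longrightarrow> \<bar>\<Sum>i\<in>E. h i * x i\<bar> \<le> C * lpn a E x"
    and R: "R \<subseteq> lines n"
    and large: "\<And>t. t \<in> R \<Longrightarrow> c * side n powr (1 / a) \<le> \<bar>\<Sum>i\<in>line t. h i\<bar>"
    and r: "2 * C * r powr (1 / a) < r * c" "2 * C * r powr (1 / a) \<le> c * side n powr (1 / a)"
  shows "card R < r"
proof (rule ccontr)
  assume "\<not> card R < r"
  then obtain R' where R': "R' \<subseteq> R" "card R' = r" "finite R'"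
    by (meson not_less obtain_subset_with_card_n)
  have *: "fst t = n" if "t \<in> R'" for t using R' R that fst_lines by blast
  have "card R' * c \<le> 2 * C * card R' powr (1 / a)"
    using large r R' C by (intro few_large_values[OF a h]) (auto simp: *)
  with R' r show False by simp
qed

text \<open>A functional on \<open>ell b\<close> is tested on lines above level \<open>n\<close>,
  with a threshold that decays in \<open>side n\<close>. \<open>few_large_values\<close> gives
  \<open>card R powr (1 / a) \<le> 2 * C / c * side n powr (1 / b)\<close>, and
  \<open>a / b = a - 1\<close>: the bound is polynomial in \<open>side n\<close>, however long the
  lines are.\<close>

lemma far_bound:
  fixes c C :: real
  assumes b: "0 < b" "1 / a + 1 / b = 1" and a: "0 < a" and C: "0 \<le> C" and c: "0 < c"
    and h: "\<And>E x. finite E \<Longrightarrow> \<bar>\<Sum>i\<in>E. h i * x i\<bar> \<le> C * lpn b E x"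
    and R: "finite R" "card R \<le> (slopes n)\<^sup>2" "\<And>t. t \<in> R \<Longrightarrow> n < fst t"
    and large: "\<And>t. t \<in> R \<Longrightarrow>
      c * side n powr (- (1 / b)) * side (fst t) powr (1 / b) \<le> \<bar>\<Sum>i\<in>line t. h i\<bar>"
    and n: "2 * C \<le> c * n powr (1 / b)"
  shows "card R \<le> (2 * C / c) powr a * side n powr (a - 1)"
proof (cases "R = {}")
  case False
  have sp: "0 < real (side n)" using side_pos by simp
  have *: "card R * (c * side n powr (- (1 / b))) \<le> 2 * C * card R powr (1 / b)"
  proof (rule few_large_values[OF b(1) h R(1) C large])
    \<comment> \<open>The smallness hypothesis: \<open>n\<close> absorbs \<open>2 * C / c\<close>,
      and \<open>side_gap\<close> leaves room for \<open>(slopes n)\<^sup>2\<close> intersections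
      and for the threshold.\<close>
    fix t assume t: "t \<in> R"
    have "2 * C * card R powr (1 / b) \<le> c * n powr (1 / b) * ((slopes n)\<^sup>2) powr (1 / b)"
      using C R(2) b c by (intro mult_mono[OF n] powr_mono2) (auto simp flip: of_nat_power)
    also have "\<dots> = c * side n powr (- (1 / b)) * (n * (slopes n)\<^sup>2 * side n) powr (1 / b)"
      using sp by (simp add: powr_mult powr_minus field_simps)
    also have "\<dots> \<le> c * side n powr (- (1 / b)) * side (fst t) powr (1 / b)"
      using side_gap[OF R(3)[OF t]] c b
      by (intro mult_left_mono powr_mono2)
        (auto simp flip: of_nat_power of_nat_mult)
    finally show "2 * C * card R powr (1 / b) \<le>
      c * side n powr (- (1 / b)) * side (fst t) powr (1 / b)" .
  qed
  have Rp: "0 < real (card R)" using False R(1) by (simp add: card_gt_0_iff)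
  have ab: "1 / a = 1 - 1 / b" "1 / b * a = a - 1"
    using b a by (auto simp: field_simps)
  have "real (card R) powr (1 / a) = card R * card R powr (- (1 / b))"
    using Rp unfolding ab(1) by (simp add: powr_diff powr_minus field_simps)
  also have "\<dots> = (card R * (c * side n powr (- (1 / b)))) * (card R powr (- (1 / b)) * side n powr (1 / b) / c)"
    using c sp by (simp add: powr_minus field_simps)
  also have "\<dots> \<le> (2 * C * card R powr (1 / b)) * (card R powr (- (1 / b)) * side n powr (1 / b) / c)"
    using * c by (intro mult_right_mono) auto
  also have "\<dots> = 2 * C / c * side n powr (1 / b)"
    using Rp by (simp add: powr_minus field_simps)
  finally have "(real (card R) powr (1 / a)) powr a \<le> (2 * C / c * side n powr (1 / b)) powr a"
    using a by (intro powr_mono2) auto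
  moreover have "(real (card R) powr (1 / a)) powr a = card R"
    using a Rp by (simp add: powr_powr)
  moreover have "(2 * C / c * side n powr (1 / b)) powr a = (2 * C / c) powr a * side n powr (a - 1)"
    using ab(2) powr_mult[of "2 * C / c" "side n powr (1 / b)" a] C c by (simp add: powr_powr)
  ultimately show ?thesis by simp
qed simp

text \<open>\<open>\<tau> t\<close> is a partner with which \<open>t\<close> makes the form large. A
  partner serves at most \<open>r\<close> lines by \<open>fibre_bound\<close>, so it suffices to
  count partners: those below level \<open>n\<close> are few by \<open>card_lines_below\<close>, and
  each one above is already large with a single point of the grid, where \<open>far_bound\<close>
  applies. The single factor \<open>slopes n\<close> comes from the grid.\<close>

lemma few_lines_for_one_form:
  fixes c C :: real and r :: nat
  assumes ab: "1 < a" "1 < b" "1 / a + 1 / b = 1" and C: "0 \<le> C" and c: "0 < c"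
    and \<beta>: "form_bound a b C \<beta>"
    and r: "2 * C * r powr (1 / a) < r * c" "2 * C * r powr (1 / a) \<le> c * side n powr (1 / a)"
    and n: "2 * C \<le> c * n powr (1 / b)"
    and J: "J \<subseteq> lines n"
    and level: "\<And>t. t \<in> J \<Longrightarrow> fst (\<tau> t) \<noteq> n \<and> \<tau> t \<in> lines (fst (\<tau> t))"
    and large: "\<And>t. t \<in> J \<Longrightarrow>
      c * side n powr (1 / a) * side (fst (\<tau> t)) powr (1 / b) \<le> \<bar>\<Sum>i\<in>line t. \<Sum>j\<in>line (\<tau> t). \<beta> i j\<bar>"
  shows "card J \<le> r * (1 + (2 * C / c) powr a) * slopes n * side n powr (a + 1)"
proof -
  have finJ: "finite J" using J finite_lines finite_subset by blast
  define T where "T = \<tau> ` J"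
  have finT: "finite T" using finJ by (simp add: T_def)
  have sp: "0 < real (side m)" for m using side_pos by simp
  have fibre: "card {t \<in> J. \<tau> t = t'} \<le> r" if "t' \<in> T" for t'
  proof (rule less_imp_le, rule fibre_bound[where n = n and r = r and C = C and c = c and a = a])
    \<comment> \<open>Contracting with the normalised indicator of \<open>t'\<close> turns the form
      into a functional on \<open>ell a\<close> of norm at most \<open>C\<close>.\<close>
    define w where "w = side (fst t') powr (- (1 / b))"
    have w: "0 < w" using sp by (simp add: w_def)
    define h where "h i = (\<Sum>j\<in>line t'. \<beta> i j * w)" for i
    show "\<bar>\<Sum>i\<in>E. h i * x i\<bar> \<le> C * lpn a E x" if "finite E" for E x
    proof -
      have "(\<Sum>i\<in>E. h i * x i) = (\<Sum>i\<in>E. \<Sum>j\<in>line t'. \<beta> i j * x i * w)"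
        by (simp add: h_def sum_distrib_left sum_distrib_right mult_ac)
      also have "\<bar>\<dots>\<bar> \<le> C * lpn a E x * lpn b (line t') (\<lambda>_. w)"
        by (rule form_boundD[OF \<beta> that finite_line])
      finally show ?thesis using ab by (simp add: w_def lpn_line)
    qed
    show "c * side n powr (1 / a) \<le> \<bar>\<Sum>i\<in>line t. h i\<bar>" if "t \<in> {t \<in> J. \<tau> t = t'}" for t
    proof -
      have "c * side n powr (1 / a) = c * side n powr (1 / a) * side (fst t') powr (1 / b) * w"
        using sp[of "fst t'"] by (simp add: w_def powr_minus)
      also have "\<dots> \<le> \<bar>\<Sum>i\<in>line t. \<Sum>j\<in>line t'. \<beta> i j\<bar> * w"
        using large[of t] that w by (intro mult_right_mono) auto
      also have "\<dots> = \<bar>\<Sum>i\<in>line t. h i\<bar>"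
        using w by (simp add: h_def abs_mult flip: sum_distrib_right)
      finally show ?thesis .
    qed
  qed (use J ab C r in auto)
  \<comment> \<open>The threshold is the average share of one point of a line of level
    \<open>n\<close>: \<open>side n powr (1 / a)\<close> divided by \<open>side n\<close>.\<close>
  define R where "R i = {t' \<in> T. n < fst t' \<and>
    c * side n powr (- (1 / b)) * side (fst t') powr (1 / b) \<le> \<bar>\<Sum>j\<in>line t'. \<beta> i j\<bar>}" for i
  have R: "card (R i) \<le> (2 * C / c) powr a * side n powr (a - 1)" for i
  proof (rule far_bound[where h = "\<beta> i" and b = b])
    show "\<bar>\<Sum>j\<in>F. \<beta> i j * y j\<bar> \<le> C * lpn b F y" if "finite F" for F y
      using form_boundD[OF \<beta> _ that, of "{i}" "\<lambda>_. 1" y] by (simp add: lpn_def)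
    have "card (R i) \<le> card T" using finT by (intro card_mono) (auto simp: R_def)
    also have "\<dots> \<le> card J" unfolding T_def by (rule card_image_le[OF finJ])
    also have "\<dots> \<le> (slopes n)\<^sup>2" using card_mono[OF finite_lines J] by (simp add: card_lines)
    finally show "card (R i) \<le> (slopes n)\<^sup>2" .
  qed (use ab C c n finT in \<open>auto simp: R_def\<close>)
  have sub: "T \<subseteq> (\<Union>m<n. lines m) \<union> (\<Union>i\<in>grid n. R i)"
  proof
    fix t' assume t': "t' \<in> T"
    then obtain t where t: "t \<in> J" "t' = \<tau> t" by (auto simp: T_def)
    show "t' \<in> (\<Union>m<n. lines m) \<union> (\<Union>i\<in>grid n. R i)"
    proof (cases "fst t' < n")
      case True
      then show ?thesis using level[OF t(1)] t(2) by auto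
    next
      case False
      then have lv: "n < fst t'" using level[OF t(1)] t(2) by auto
      \<comment> \<open>Pigeonhole: if every point of the line stayed below the threshold, the
        \<open>side n\<close> points together would stay below the bound in
        \<open>large\<close>.\<close>
      have "\<exists>i\<in>line t. c * side n powr (- (1 / b)) * side (fst t') powr (1 / b) \<le> \<bar>\<Sum>j\<in>line t'. \<beta> i j\<bar>"
      proof (rule ccontr)
        assume *: "\<not> ?thesis"
        have cl: "card (line t) = side n" using fst_lines[of t n] t(1) J by (auto simp: card_line)
        then have ne: "line t \<noteq> {}" using side_pos[of n] by auto
        have "\<bar>\<Sum>i\<in>line t. \<Sum>j\<in>line t'. \<beta> i j\<bar> \<le> (\<Sum>i\<in>line t. \<bar>\<Sum>j\<in>line t'. \<beta> i j\<bar>)"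
          by (rule sum_abs)
        also have "\<dots> < (\<Sum>i\<in>line t. c * side n powr (- (1 / b)) * side (fst t') powr (1 / b))"
          using * ne finite_line by (intro sum_strict_mono) auto
        also have "\<dots> = c * (side n * side n powr (- (1 / b))) * side (fst t') powr (1 / b)"
          by (simp add: cl)
        also have "side n * side n powr (- (1 / b)) = side n powr (1 / a)"
        proof -
          have "1 / a = 1 - 1 / b" using ab by simp
          then show ?thesis using sp[of n] by (simp add: powr_diff powr_minus_divide)
        qed
        finally show False using large[OF t(1)] t(2) by simp
      qed
      then show ?thesis using line_subset_grid[of t n] t t' J lv by (auto simp: R_def)
    qed
  qed
  have "card T \<le> card ((\<Union>m<n. lines m) \<union> (\<Union>i\<in>grid n. R i))"
    using sub finT by (intro card_mono) (auto simp: finite_lines finite_grid R_def)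
  also have "\<dots> \<le> card (\<Union>m<n. lines m) + card (\<Union>i\<in>grid n. R i)"
    by (rule card_Un_le)
  also have "\<dots> \<le> side n + (\<Sum>i\<in>grid n. card (R i))"
    using card_lines_below card_UN_le[OF finite_grid, of R n] by (intro add_mono) auto
  finally have "real (card T) \<le> side n + (\<Sum>i\<in>grid n. real (card (R i)))"
    by (simp flip: of_nat_sum of_nat_add)
  also have "(\<Sum>i\<in>grid n. real (card (R i))) \<le> card (grid n) * ((2 * C / c) powr a * side n powr (a - 1))"
    using R by (intro sum_bounded_above)
  also have "\<dots> \<le> (slopes n * (side n)\<^sup>2) * ((2 * C / c) powr a * side n powr (a - 1))"
    using card_grid[of n] by (intro mult_right_mono)
      (auto simp flip: of_nat_mult of_nat_power)
  also have "\<dots> = (2 * C / c) powr a * slopes n * side n powr (a + 1)"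
  proof -
    have "a + 1 = 2 + (a - 1)" by simp
    then have "real (side n) powr (a + 1) = side n powr 2 * side n powr (a - 1)"
      by (simp only: powr_add)
    then show ?thesis using sp[of n] by simp
  qed
  finally have T0: "card T \<le> side n + (2 * C / c) powr a * slopes n * side n powr (a + 1)"
    by simp
  \<comment> \<open>Absorbs the count of the levels below \<open>n\<close> into the main
    term.\<close>
  have side_le: "real (side n) \<le> slopes n * side n powr (a + 1)"
  proof -
    have "1 * side n powr 1 \<le> slopes n * side n powr (a + 1)"
      using slopes_pos[of n] side_pos[of n] ab by (intro mult_mono powr_mono) auto
    then show ?thesis by simp
  qed
  have T: "card T \<le> (1 + (2 * C / c) powr a) * slopes n * side n powr (a + 1)"
    using T0 side_le by (simp add: algebra_simps)
  have "card J = (\<Sum>t\<in>J. 1)" by simp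
  also have "\<dots> = (\<Sum>t'\<in>T. \<Sum>t\<in>{t \<in> J. \<tau> t = t'}. 1)"
    unfolding T_def by (rule sum.image_gen[OF finJ])
  also have "\<dots> \<le> (\<Sum>t'\<in>T. r)" using fibre by (intro sum_mono) simp
  finally have "card J \<le> r * card T" by (simp add: mult.commute)
  then have "real (card J) \<le> r * real (card T)" by (metis of_nat_le_iff of_nat_mult)
  also have "\<dots> \<le> r * ((1 + (2 * C / c) powr a) * slopes n * side n powr (a + 1))"
    using T by (intro mult_left_mono) auto
  finally show ?thesis by (simp add: mult_ac)
qed

text \<open>Summing over the finitely many forms would give
  \<open>(slopes n)\<^sup>2 \<le> K * slopes n * side n powr (a + 1)\<close>. After cancelling
  \<open>slopes n\<close>, the exponent \<open>n\<close> in its definition wins as soon as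
  \<open>n\<close> is at least \<open>K\<close> and \<open>a + 2\<close>.\<close>

lemma no_domination_on_large_level:
  fixes c C :: real
  assumes ab: "1 < a" "1 < b" "1 / a + 1 / b = 1" and C: "0 \<le> C" and c: "0 < c"
    and fin: "finite \<B>" and \<B>: "\<And>\<beta>. \<beta> \<in> \<B> \<Longrightarrow> form_bound a b C \<beta>"
  shows "\<forall>\<^sub>F n in sequentially. \<not> (\<forall>t\<in>lines n. \<exists>\<beta>\<in>\<B>. \<exists>m. m \<noteq> n \<and> (\<exists>t'\<in>lines m.
    c * side n powr (1 / a) * side m powr (1 / b) \<le> \<bar>\<Sum>i\<in>line t. \<Sum>j\<in>line t'. \<beta> i j\<bar>))"
proof -
  have lim: "filterlim (\<lambda>n. c * real n powr e) at_top sequentially" if "0 < e" for e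
    using c that by real_asymp
  have "1 / b > 0" "1 / a > 0" using ab by auto
  note lims = lim[OF this(1)] lim[OF this(2)]
  \<comment> \<open>\<open>r\<close> is fixed before \<open>n\<close>. Multiplying by
    \<open>r powr (1 / a)\<close> will give the first condition of \<open>fibre_bound\<close>; the
    extra \<open>c\<close> makes it strict.\<close>
  have "\<forall>\<^sub>F r in sequentially. 2 * C + c \<le> c * real r powr (1 / b) \<and> 0 < r"
    using lims(1) eventually_gt_at_top[of "0::nat"]
    by (auto simp: filterlim_at_top intro: eventually_conj)
  then obtain r :: nat where r: "2 * C + c \<le> c * real r powr (1 / b)" "0 < r"
    using eventually_happens'[OF sequentially_bot] by blast
  have "2 * C * r powr (1 / a) < c * real r powr (1 / b) * r powr (1 / a)"
    using r c by (intro mult_strict_right_mono) auto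
  also have "\<dots> = c * real r powr (1 / a + 1 / b)" by (simp add: powr_add)
  finally have r1: "2 * C * r powr (1 / a) < r * c" using r unfolding ab by (simp add: mult.commute)
  define K where "K = card \<B> * (r * (1 + (2 * C / c) powr a))"
  have "\<forall>\<^sub>F n in sequentially. 2 * C * r powr (1 / a) \<le> c * real n powr (1 / a)"
    using lims(2) by (auto simp: filterlim_at_top)
  moreover have "\<forall>\<^sub>F n in sequentially. 2 * C \<le> c * real n powr (1 / b)"
    using lims(1) by (auto simp: filterlim_at_top)
  moreover have "\<forall>\<^sub>F n in sequentially. a + 2 \<le> real n" by real_asymp
  moreover have "\<forall>\<^sub>F n in sequentially. K \<le> real n" by real_asymp
  ultimately show ?thesis
  proof eventually_elim
    case (elim n)
    have sn: "real n < side n" using side_gt[of n] by simp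
    have r2: "2 * C * r powr (1 / a) \<le> c * side n powr (1 / a)"
    proof -
      have "c * real n powr (1 / a) \<le> c * side n powr (1 / a)"
        using sn c ab by (intro mult_left_mono powr_mono2) auto
      with elim(1) show ?thesis by linarith
    qed
    show ?case
    proof
      assume "\<forall>t\<in>lines n. \<exists>\<beta>\<in>\<B>. \<exists>m. m \<noteq> n \<and> (\<exists>t'\<in>lines m.
        c * side n powr (1 / a) * side m powr (1 / b) \<le> \<bar>\<Sum>i\<in>line t. \<Sum>j\<in>line t'. \<beta> i j\<bar>)"
      then have "\<forall>t\<in>lines n. \<exists>q. fst q \<in> \<B> \<and> fst (snd q) \<noteq> n \<and> snd q \<in> lines (fst (snd q)) \<and>
        c * side n powr (1 / a) * side (fst (snd q)) powr (1 / b) \<le> \<bar>\<Sum>i\<in>line t. \<Sum>j\<in>line (snd q). fst q i j\<bar>"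
        using fst_lines by (metis fst_conv snd_conv)
      then obtain q where q: "\<And>t. t \<in> lines n \<Longrightarrow> fst (q t) \<in> \<B> \<and> fst (snd (q t)) \<noteq> n \<and>
        snd (q t) \<in> lines (fst (snd (q t))) \<and>
        c * side n powr (1 / a) * side (fst (snd (q t))) powr (1 / b) \<le>
          \<bar>\<Sum>i\<in>line t. \<Sum>j\<in>line (snd (q t)). fst (q t) i j\<bar>"
        by metis
      \<comment> \<open>The lines are sorted by the form that dominates them.\<close>
      define J where "J \<beta> = {t \<in> lines n. fst (q t) = \<beta>}" for \<beta>
      have J: "card (J \<beta>) \<le> r * (1 + (2 * C / c) powr a) * slopes n * side n powr (a + 1)"
        if "\<beta> \<in> \<B>" for \<beta>
        using few_lines_for_one_form[OF ab C c \<B>[OF that] r1 r2 elim(2), of "J \<beta>" "\<lambda>t. snd (q t)"] q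
        by (auto simp: J_def)
      have "lines n = (\<Union>\<beta>\<in>\<B>. J \<beta>)" using q by (auto simp: J_def)
      then have "card (lines n) \<le> (\<Sum>\<beta>\<in>\<B>. card (J \<beta>))" using card_UN_le[OF fin, of J] by simp
      then have "real ((slopes n)\<^sup>2) \<le> (\<Sum>\<beta>\<in>\<B>. real (card (J \<beta>)))"
        unfolding card_lines by (simp only: of_nat_le_iff flip: of_nat_sum)
      also have "\<dots> \<le> card \<B> * (r * (1 + (2 * C / c) powr a) * slopes n * side n powr (a + 1))"
        using J by (intro sum_bounded_above)
      finally have "slopes n * real (slopes n) \<le> slopes n * (K * side n powr (a + 1))"
        by (simp add: K_def power2_eq_square mult_ac)
      then have "real (slopes n) \<le> K * side n powr (a + 1)"
        using slopes_pos[of n] by simp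
      also have "\<dots> < side n * side n powr (a + 1)"
        using elim sn side_pos[of n] by (intro mult_strict_right_mono) auto
      also have "\<dots> = side n powr (a + 2)"
        using side_pos[of n] by (simp add: powr_add power2_eq_square)
      also have "\<dots> \<le> side n powr real n"
        using elim side_pos[of n] by (intro powr_mono) auto
      also have "\<dots> = slopes n"
        using side_pos[of n] by (simp add: slopes_def powr_realpow)
      finally show False by simp
    qed
  qed
qed

section \<open>Sequence spaces and their operators\<close>

lemma lpn_nonneg: "0 \<le> lpn a E x"
  by (simp add: lpn_def)

lemma lpn_powr: "0 < a \<Longrightarrow> lpn a E x powr a = (\<Sum>i\<in>E. \<bar>x i\<bar> powr a)"
  by (simp add: lpn_def powr_powr sum_nonneg)

lemma Holder_sum:
  assumes ab: "1 < a" "1 < b" "1 / a + 1 / b = 1" and E: "finite E"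
  shows "\<bar>\<Sum>i\<in>E. x i * y i\<bar> \<le> lpn a E x * lpn b E y"
proof (cases "lpn a E x = 0 \<or> lpn b E y = 0")
  case True
  have "x i * y i = 0" if "i \<in> E" for i
    using True that E by (auto simp: lpn_def sum_nonneg_eq_0_iff)
  then have "(\<Sum>i\<in>E. x i * y i) = 0" by (intro sum.neutral) auto
  then show ?thesis by (simp add: lpn_nonneg)
next
  case False
  define s where "s = lpn a E x"
  define t where "t = lpn b E y"
  have st: "0 < s" "0 < t" using False lpn_nonneg by (simp_all add: s_def t_def less_le)
  have sa: "s powr a = (\<Sum>i\<in>E. \<bar>x i\<bar> powr a)" and tb: "t powr b = (\<Sum>i\<in>E. \<bar>y i\<bar> powr b)"
    using ab by (auto simp: s_def t_def lpn_powr)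
  have "(\<Sum>i\<in>E. \<bar>x i\<bar> / s * (\<bar>y i\<bar> / t)) \<le>
      (\<Sum>i\<in>E. (\<bar>x i\<bar> / s) powr a / a + (\<bar>y i\<bar> / t) powr b / b)"
    using ab st by (intro sum_mono Youngs_inequality) auto
  also have "\<dots> = (\<Sum>i\<in>E. \<bar>x i\<bar> powr a) / s powr a / a + (\<Sum>i\<in>E. \<bar>y i\<bar> powr b) / t powr b / b"
    using st by (simp add: powr_divide sum.distrib flip: sum_divide_distrib)
  also have "\<dots> = 1" using st ab by (simp flip: sa tb)
  finally have "(\<Sum>i\<in>E. \<bar>x i\<bar> * \<bar>y i\<bar>) / (s * t) \<le> 1"
    by (simp add: sum_divide_distrib)
  then have "(\<Sum>i\<in>E. \<bar>x i\<bar> * \<bar>y i\<bar>) \<le> s * t" using st by simp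
  moreover have "\<bar>\<Sum>i\<in>E. x i * y i\<bar> \<le> (\<Sum>i\<in>E. \<bar>x i\<bar> * \<bar>y i\<bar>)"
    by (simp add: order.trans[OF sum_abs] flip: abs_mult)
  ultimately show ?thesis by (simp add: s_def t_def)
qed

text \<open>The equality case of Hoelder: \<open>y\<close> is the normalised
  \<open>sgn (x i) * \<bar>x i\<bar> powr (a - 1)\<close>, whose \<open>b\<close>-norm is one
  because \<open>(a - 1) * b = a\<close>.\<close>

lemma lpn_attained:
  assumes ab: "1 < a" "1 < b" "1 / a + 1 / b = 1" and E: "finite E"
  shows "\<exists>y. lpn b E y \<le> 1 \<and> (\<Sum>i\<in>E. x i * y i) = lpn a E x"
proof (cases "lpn a E x = 0")
  case True
  then show ?thesis using ab by (intro exI[of _ "\<lambda>_. 0"]) (simp add: lpn_def)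
next
  case False
  define s where "s = lpn a E x"
  have s: "0 < s" using False lpn_nonneg by (simp add: s_def less_le)
  have sa: "s powr a = (\<Sum>i\<in>E. \<bar>x i\<bar> powr a)" using ab by (simp add: s_def lpn_powr)
  define y where "y i = sgn (x i) * (\<bar>x i\<bar> / s) powr (a - 1)" for i
  have ab': "(a - 1) * b = a" using ab by (simp add: field_simps)
  have "\<bar>y i\<bar> powr b = \<bar>x i\<bar> powr a / s powr a" for i
    using s ab by (simp add: y_def abs_mult abs_sgn_eq powr_powr ab' powr_divide)
  then have "(\<Sum>i\<in>E. \<bar>y i\<bar> powr b) = 1"
    using s by (simp add: sa[symmetric] flip: sum_divide_distrib)
  then have 1: "lpn b E y = 1" by (simp add: lpn_def)
  have "x i * y i = \<bar>x i\<bar> powr a / s powr (a - 1)" for i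
  proof (cases "x i = 0")
    case False
    have "x i * y i = \<bar>x i\<bar> * \<bar>x i\<bar> powr (a - 1) / s powr (a - 1)"
      using s by (simp add: y_def powr_divide abs_sgn mult.assoc)
    then show ?thesis using False by (simp add: powr_diff)
  qed (simp add: y_def)
  then have "(\<Sum>i\<in>E. x i * y i) = s powr a / s powr (a - 1)"
    by (simp add: sa flip: sum_divide_distrib)
  also have "\<dots> = s" using s by (simp flip: powr_diff)
  finally have "(\<Sum>i\<in>E. x i * y i) = lpn a E x" by (simp only: s_def)
  then show ?thesis using 1 by (intro exI[of _ y]) simp
qed

text \<open>By duality: \<open>lpn_attained\<close> supplies a \<open>y\<close> that norms the sum,
  and Hoelder bounds its value on each summand.\<close>

lemma Minkowski_sum:
  assumes ab: "1 < a" "1 < b" "1 / a + 1 / b = 1" and E: "finite E"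
  shows "lpn a E (\<lambda>i. \<Sum>t\<in>T. z t * x t i) \<le> (\<Sum>t\<in>T. \<bar>z t\<bar> * lpn a E (x t))"
proof -
  obtain y where y: "lpn b E y \<le> 1"
    "(\<Sum>i\<in>E. (\<Sum>t\<in>T. z t * x t i) * y i) = lpn a E (\<lambda>i. \<Sum>t\<in>T. z t * x t i)"
    using lpn_attained[OF ab E, of "\<lambda>i. \<Sum>t\<in>T. z t * x t i"] by auto
  have "lpn a E (\<lambda>i. \<Sum>t\<in>T. z t * x t i) = (\<Sum>i\<in>E. \<Sum>t\<in>T. z t * (x t i * y i))"
    using y(2) by (simp only: sum_distrib_right mult.assoc)
  also have "\<dots> = (\<Sum>t\<in>T. z t * (\<Sum>i\<in>E. x t i * y i))"
    by (subst sum.swap) (simp add: sum_distrib_left)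
  also have "\<dots> \<le> (\<Sum>t\<in>T. \<bar>z t\<bar> * lpn a E (x t))"
  proof (rule sum_mono)
    fix t
    have "\<bar>\<Sum>i\<in>E. x t i * y i\<bar> \<le> lpn a E (x t) * lpn b E y" by (rule Holder_sum[OF ab E])
    also have "\<dots> \<le> lpn a E (x t) * 1" using y(1) by (intro mult_left_mono lpn_nonneg)
    finally have "\<bar>z t\<bar> * \<bar>\<Sum>i\<in>E. x t i * y i\<bar> \<le> \<bar>z t\<bar> * lpn a E (x t)"
      by (intro mult_left_mono) auto
    then show "z t * (\<Sum>i\<in>E. x t i * y i) \<le> \<bar>z t\<bar> * lpn a E (x t)"
      using abs_ge_self[of "z t * (\<Sum>i\<in>E. x t i * y i)"] by (simp only: abs_mult)
  qed
  finally show ?thesis .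
qed

text \<open>The constant 4 replaces the triangle inequality; boundedness of sums needs no more.\<close>

locale quasinormed =
  fixes X :: seqspace
  assumes zero_in: "(\<lambda>_. 0) \<in> vecs X"
    and add_in: "x \<in> vecs X \<Longrightarrow> y \<in> vecs X \<Longrightarrow> (\<lambda>n. x n + y n) \<in> vecs X"
    and scale_in: "x \<in> vecs X \<Longrightarrow> (\<lambda>n. c * x n) \<in> vecs X"
    and nrm_nonneg: "x \<in> vecs X \<Longrightarrow> 0 \<le> nrm X x"
    and nrm_scale: "x \<in> vecs X \<Longrightarrow> nrm X (\<lambda>n. c * x n) = \<bar>c\<bar> * nrm X x"
    and nrm_add: "x \<in> vecs X \<Longrightarrow> y \<in> vecs X \<Longrightarrow> nrm X (\<lambda>n. x n + y n) \<le> 4 * (nrm X x + nrm X y)"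

section \<open>Bounded operators between sequence spaces\<close>

lemma operatorsD:
  assumes "T \<in> operators X Y"
  shows operators_in: "x \<in> vecs X \<Longrightarrow> T x \<in> vecs Y"
    and operators_add: "x \<in> vecs X \<Longrightarrow> y \<in> vecs X \<Longrightarrow> T (\<lambda>n. x n + y n) = (\<lambda>n. T x n + T y n)"
    and operators_scale: "x \<in> vecs X \<Longrightarrow> T (\<lambda>n. c * x n) = (\<lambda>n. c * T x n)"
  using assms unfolding operators_def by (auto simp: PiE_iff)

lemma restrict_operatorI:
  assumes "\<And>x. x \<in> vecs X \<Longrightarrow> T x \<in> vecs Y"
    and "\<And>x y. x \<in> vecs X \<Longrightarrow> y \<in> vecs X \<Longrightarrow> T (\<lambda>n. x n + y n) = (\<lambda>n. T x n + T y n)"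
    and "\<And>c x. x \<in> vecs X \<Longrightarrow> T (\<lambda>n. c * x n) = (\<lambda>n. c * T x n)"
    and "\<And>x. x \<in> vecs X \<Longrightarrow> nrm Y (T x) \<le> C * nrm X x"
    and "quasinormed X"
  shows "restrict T (vecs X) \<in> operators X Y"
proof -
  interpret quasinormed X by fact
  have "\<exists>C. \<forall>x\<in>vecs X. nrm Y (restrict T (vecs X) x) \<le> C * nrm X x"
    by (intro exI[of _ C]) (simp add: assms(4))
  then show ?thesis
    by (simp add: operators_def add_in scale_in assms(1-3))
qed

lemma operators_bound:
  assumes "T \<in> operators X Y" "quasinormed X"
  obtains C where "0 < C" "\<And>x. x \<in> vecs X \<Longrightarrow> nrm Y (T x) \<le> C * nrm X x"
proof -
  interpret quasinormed X by fact
  obtain C where C: "\<And>x. x \<in> vecs X \<Longrightarrow> nrm Y (T x) \<le> C * nrm X x"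
    using assms unfolding operators_def by blast
  have "nrm Y (T x) \<le> (\<bar>C\<bar> + 1) * nrm X x" if "x \<in> vecs X" for x
  proof -
    have "C * nrm X x \<le> (\<bar>C\<bar> + 1) * nrm X x"
      using nrm_nonneg[OF that] by (intro mult_right_mono) auto
    then show ?thesis using C[OF that] by linarith
  qed
  then show ?thesis by (intro that[of "\<bar>C\<bar> + 1"]) auto
qed

lemma op_zero_in:
  assumes "quasinormed X" "quasinormed Y"
  shows "op_zero X \<in> operators X Y"
proof -
  interpret X: quasinormed X by fact
  interpret Y: quasinormed Y by fact
  show ?thesis unfolding op_zero_def
    using Y.nrm_scale[OF Y.zero_in, of 0] Y.zero_in assms(1)
    by (intro restrict_operatorI[where C = 0]) auto
qed

lemma op_lincomb_in:
  assumes S: "S \<in> operators X Y" and T: "T \<in> operators X Y"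
    and XY: "quasinormed X" "quasinormed Y"
  shows "(\<lambda>x\<in>vecs X. \<lambda>n. c * S x n + d * T x n) \<in> operators X Y"
proof -
  interpret X: quasinormed X by fact
  interpret Y: quasinormed Y by fact
  obtain CS where CS: "0 < CS" "\<And>x. x \<in> vecs X \<Longrightarrow> nrm Y (S x) \<le> CS * nrm X x"
    using operators_bound[OF S XY(1)] by blast
  obtain CT where CT: "0 < CT" "\<And>x. x \<in> vecs X \<Longrightarrow> nrm Y (T x) \<le> CT * nrm X x"
    using operators_bound[OF T XY(1)] by blast
  show ?thesis
  proof (intro restrict_operatorI[where C = "4 * (\<bar>c\<bar> * CS + \<bar>d\<bar> * CT)"])
    fix x assume x: "x \<in> vecs X"
    note Sx = operators_in[OF S x] and Tx = operators_in[OF T x]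
    show "(\<lambda>n. c * S x n + d * T x n) \<in> vecs Y"
      by (intro Y.add_in Y.scale_in Sx Tx)
    have "nrm Y (\<lambda>n. c * S x n + d * T x n) \<le> 4 * (\<bar>c\<bar> * nrm Y (S x) + \<bar>d\<bar> * nrm Y (T x))"
      using Y.nrm_add[OF Y.scale_in[OF Sx, of c] Y.scale_in[OF Tx, of d]]
      by (simp add: Y.nrm_scale Sx Tx)
    also have "\<dots> \<le> 4 * (\<bar>c\<bar> * (CS * nrm X x) + \<bar>d\<bar> * (CT * nrm X x))"
      using CS(2)[OF x] CT(2)[OF x] by (intro mult_left_mono add_mono) auto
    finally show "nrm Y (\<lambda>n. c * S x n + d * T x n) \<le> 4 * (\<bar>c\<bar> * CS + \<bar>d\<bar> * CT) * nrm X x"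
      by (simp add: algebra_simps)
  next
    fix x y assume "x \<in> vecs X" "y \<in> vecs X"
    then show "(\<lambda>n. c * S (\<lambda>n. x n + y n) n + d * T (\<lambda>n. x n + y n) n) =
      (\<lambda>n. (c * S x n + d * T x n) + (c * S y n + d * T y n))"
      by (simp only: operators_add[OF S] operators_add[OF T]) (simp add: algebra_simps)
  next
    fix e x assume "x \<in> vecs X"
    then show "(\<lambda>n. c * S (\<lambda>n. e * x n) n + d * T (\<lambda>n. e * x n) n) =
      (\<lambda>n. e * (c * S x n + d * T x n))"
      by (simp only: operators_scale[OF S] operators_scale[OF T]) (simp add: algebra_simps)
  qed fact
qed

lemma op_add_in:
  assumes "S \<in> operators X Y" "T \<in> operators X Y" "quasinormed X" "quasinormed Y"
  shows "op_add X S T \<in> operators X Y"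
  using op_lincomb_in[OF assms, of 1 1] by (simp add: op_add_def)

lemma op_diff_in:
  assumes "S \<in> operators X Y" "T \<in> operators X Y" "quasinormed X" "quasinormed Y"
  shows "op_diff X S T \<in> operators X Y"
  using op_lincomb_in[OF assms, of 1 "-1"] by (simp add: op_diff_def)

lemma op_scale_in:
  assumes "T \<in> operators X Y" "quasinormed X" "quasinormed Y"
  shows "op_scale X c T \<in> operators X Y"
  using op_lincomb_in[OF assms(1,1-3), of c 0] by (simp add: op_scale_def)

lemma op_comp_in:
  assumes A: "A \<in> operators Y Z" and B: "B \<in> operators X Y"
    and XY: "quasinormed X" "quasinormed Y"
  shows "restrict (A \<circ> B) (vecs X) \<in> operators X Z"
proof -
  obtain CA where CA: "0 < CA" "\<And>x. x \<in> vecs Y \<Longrightarrow> nrm Z (A x) \<le> CA * nrm Y x"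
    using operators_bound[OF A XY(2)] by blast
  obtain CB where CB: "0 < CB" "\<And>x. x \<in> vecs X \<Longrightarrow> nrm Y (B x) \<le> CB * nrm X x"
    using operators_bound[OF B XY(1)] by blast
  show ?thesis
  proof (intro restrict_operatorI[where C = "CA * CB"])
    fix x assume x: "x \<in> vecs X"
    have "nrm Z (A (B x)) \<le> CA * nrm Y (B x)" by (intro CA(2) operators_in[OF B] x)
    also have "\<dots> \<le> CA * (CB * nrm X x)" using CB(2)[OF x] CA(1) by simp
    finally show "nrm Z ((A \<circ> B) x) \<le> CA * CB * nrm X x" by (simp add: mult.assoc)
  qed (use XY in \<open>auto simp: operators_in[OF A] operators_in[OF B] operators_add[OF A]
      operators_add[OF B] operators_scale[OF A] operators_scale[OF B]\<close>)
qed

lemma op_sandwich_in: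
  assumes "A \<in> operators Y Z" "T \<in> operators X Y" "B \<in> operators W X"
    and "quasinormed W" "quasinormed X" "quasinormed Y"
  shows "restrict (A \<circ> T \<circ> B) (vecs W) \<in> operators W Z"
proof -
  have "restrict (A \<circ> T \<circ> B) (vecs W) = restrict (A \<circ> restrict (T \<circ> B) (vecs W)) (vecs W)"
    by (auto simp: restrict_def fun_eq_iff)
  then show ?thesis using assms by (auto intro!: op_comp_in)
qed

lemma op_id_in: "quasinormed X \<Longrightarrow> (\<lambda>x\<in>vecs X. x) \<in> operators X X"
  by (intro restrict_operatorI[where C = 1]) auto

lemma nrm_le_opnorm:
  assumes T: "T \<in> operators X Y" and XY: "quasinormed X" "quasinormed Y" and x: "x \<in> vecs X"
  shows "nrm Y (T x) \<le> opnorm X Y T * nrm X x"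
proof -
  interpret X: quasinormed X by fact
  interpret Y: quasinormed Y by fact
  obtain C where C: "0 < C" "\<And>x. x \<in> vecs X \<Longrightarrow> nrm Y (T x) \<le> C * nrm X x"
    using operators_bound[OF T XY(1)] by blast
  show ?thesis
  proof (cases "nrm X x = 0")
    \<comment> \<open>The locale does not make the norm definite, but boundedness of
      \<open>T\<close> gives \<open>nrm Y (T x) \<le> 0\<close>.\<close>
    case True
    then show ?thesis using C(2)[OF x] by simp
  next
    case False
    then have pos: "0 < nrm X x" using X.nrm_nonneg[OF x] by simp
    define u where "u = (\<lambda>n. 1 / nrm X x * x n)"
    have u: "u \<in> vecs X" "nrm X u = 1"
      unfolding u_def by (simp_all only: X.scale_in X.nrm_scale x) (use pos in simp)
    have "bdd_above ((\<lambda>x. nrm Y (T x)) ` {x \<in> vecs X. nrm X x \<le> 1})"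
    proof (rule bdd_aboveI2)
      fix z assume "z \<in> {x \<in> vecs X. nrm X x \<le> 1}"
      then show "nrm Y (T z) \<le> C"
        using C(2)[of z] C(1) mult_left_mono[of "nrm X z" 1 C] by (auto intro: order.trans)
    qed
    then have "nrm Y (T u) \<le> opnorm X Y T"
      unfolding opnorm_def using u by (intro cSUP_upper) auto
    moreover have "nrm Y (T u) = 1 / nrm X x * nrm Y (T x)"
      using pos unfolding u_def by (simp only: operators_scale[OF T x] Y.nrm_scale operators_in[OF T x]) simp
    ultimately show ?thesis using pos by (simp add: field_simps)
  qed
qed

section \<open>Finitely supported vectors\<close>

definition unit_vec :: "nat \<Rightarrow> nat \<Rightarrow> real" where
  "unit_vec i = (\<lambda>k. if k = i then 1 else 0)"

definition cut :: "nat set \<Rightarrow> (nat \<Rightarrow> real) \<Rightarrow> nat \<Rightarrow> real" where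
  "cut E x = (\<lambda>i. if i \<in> E then x i else 0)"

lemma cut_insert:
  "e \<notin> E \<Longrightarrow> cut (insert e E) x = (\<lambda>n. x e * unit_vec e n + cut E x n)"
  by (auto simp: cut_def unit_vec_def fun_eq_iff)

lemma cut_in:
  assumes "quasinormed X" "\<And>i. unit_vec i \<in> vecs X" "finite E"
  shows "cut E x \<in> vecs X"
proof -
  interpret quasinormed X by fact
  show ?thesis using assms(3)
  proof induction
    case empty
    then show ?case using zero_in by (simp add: cut_def)
  next
    case (insert e E)
    then show ?case by (simp add: cut_insert add_in scale_in assms)
  qed
qed

text \<open>Stated for scalar values, to serve both a coordinate of an operator and a
  functional.\<close>

lemma linear_cut:
  fixes f :: "(nat \<Rightarrow> real) \<Rightarrow> real"
  assumes X: "quasinormed X" "\<And>i. unit_vec i \<in> vecs X" and E: "finite E"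
    and add: "\<And>x y. x \<in> vecs X \<Longrightarrow> y \<in> vecs X \<Longrightarrow> f (\<lambda>n. x n + y n) = f x + f y"
    and scale: "\<And>c x. x \<in> vecs X \<Longrightarrow> f (\<lambda>n. c * x n) = c * f x"
  shows "f (cut E x) = (\<Sum>i\<in>E. x i * f (unit_vec i))"
proof -
  interpret quasinormed X by fact
  show ?thesis using E
  proof induction
    case empty
    then show ?case using scale[OF zero_in, of 0] by (simp add: cut_def)
  next
    case (insert e E)
    then show ?case
      by (simp add: cut_insert add scale scale_in X cut_in)
  qed
qed

section \<open>The spaces \<open>ell p\<close> and \<open>ell_infinity\<close>, and the matrix of an
  operator\<close>

lemma ell_simps [simp]:
  "x \<in> vecs (ell p) \<longleftrightarrow> summable (\<lambda>n. \<bar>x n\<bar> powr p)"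
  "nrm (ell p) x = (\<Sum>n. \<bar>x n\<bar> powr p) powr (1 / p)"
  by (auto simp: ell_def)

text \<open>Two crude estimates by \<open>2 powr p\<close>, one pointwise and one for the two sums,
  become the constant 4 under the power \<open>1 / p\<close>.\<close>

lemma quasinormed_ell:
  assumes p: "1 \<le> p"
  shows "quasinormed (ell p)"
proof
  show "(\<lambda>_. 0) \<in> vecs (ell p)" using p by simp
  fix x c assume x: "x \<in> vecs (ell p)"
  have pc: "\<bar>c * x n\<bar> powr p = \<bar>c\<bar> powr p * \<bar>x n\<bar> powr p" for n
    by (simp add: abs_mult powr_mult)
  show "(\<lambda>n. c * x n) \<in> vecs (ell p)"
    using x unfolding ell_simps pc by (intro summable_mult)
  show "0 \<le> nrm (ell p) x" by simp
  show "nrm (ell p) (\<lambda>n. c * x n) = \<bar>c\<bar> * nrm (ell p) x"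
    using x p unfolding ell_simps pc
    by (subst suminf_mult) (simp_all add: powr_mult powr_powr suminf_nonneg)
next
  fix x y assume x: "x \<in> vecs (ell p)" and y: "y \<in> vecs (ell p)"
  have le: "\<bar>x n + y n\<bar> powr p \<le> 2 powr p * (\<bar>x n\<bar> powr p + \<bar>y n\<bar> powr p)" for n
  proof -
    have "\<bar>x n + y n\<bar> powr p \<le> (2 * max \<bar>x n\<bar> \<bar>y n\<bar>) powr p"
      using p by (intro powr_mono2) auto
    also have "\<dots> = 2 powr p * (max \<bar>x n\<bar> \<bar>y n\<bar>) powr p" by (simp add: powr_mult)
    also have "\<dots> \<le> 2 powr p * (\<bar>x n\<bar> powr p + \<bar>y n\<bar> powr p)"
      by (intro mult_left_mono) (auto simp: max_def)
    finally show ?thesis .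
  qed
  have s: "summable (\<lambda>n. 2 powr p * (\<bar>x n\<bar> powr p + \<bar>y n\<bar> powr p))"
    using x y by (intro summable_mult summable_add) auto
  have s': "summable (\<lambda>n. \<bar>x n + y n\<bar> powr p)"
    by (rule summable_comparison_test[OF _ s]) (use le in auto)
  then show "(\<lambda>n. x n + y n) \<in> vecs (ell p)" by simp
  define u where "u = (\<Sum>n. \<bar>x n\<bar> powr p)"
  define v where "v = (\<Sum>n. \<bar>y n\<bar> powr p)"
  have uv: "0 \<le> u" "0 \<le> v" using x y by (auto simp: u_def v_def suminf_nonneg)
  have "(\<Sum>n. \<bar>x n + y n\<bar> powr p) \<le> (\<Sum>n. 2 powr p * (\<bar>x n\<bar> powr p + \<bar>y n\<bar> powr p))"
    by (intro suminf_le le s s')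
  also have "\<dots> = 2 powr p * (u + v)"
    using x y by (subst suminf_mult) (auto simp: u_def v_def suminf_add intro: summable_add)
  also have "\<dots> \<le> 2 powr p * (2 powr p * max u v)"
  proof (intro mult_left_mono)
    have "(2::real) powr 1 \<le> 2 powr p" using p by (intro powr_mono) auto
    then have "2 * max u v \<le> 2 powr p * max u v" using uv by (intro mult_right_mono) auto
    then show "u + v \<le> 2 powr p * max u v" by linarith
  qed auto
  finally have "nrm (ell p) (\<lambda>n. x n + y n) \<le> (2 powr p * (2 powr p * max u v)) powr (1 / p)"
    unfolding ell_simps using p s' by (intro powr_mono2) (auto simp: suminf_nonneg)
  also have "\<dots> = 4 * (max u v) powr (1 / p)"
    using p by (simp add: powr_mult powr_powr)
  also have "\<dots> \<le> 4 * (u powr (1 / p) + v powr (1 / p))"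
    by (auto simp: max_def)
  finally show "nrm (ell p) (\<lambda>n. x n + y n) \<le> 4 * (nrm (ell p) x + nrm (ell p) y)"
    by (simp add: u_def v_def)
qed

lemma ell_infinity_in: "x \<in> vecs ell_infinity \<longleftrightarrow> (\<exists>b. \<forall>n. \<bar>x n\<bar> \<le> b)"
  by (auto simp: ell_infinity_def bounded_iff)

lemma abs_le_nrm_ell_infinity: "x \<in> vecs ell_infinity \<Longrightarrow> \<bar>x i\<bar> \<le> nrm ell_infinity x"
  unfolding ell_infinity_in by (auto simp: ell_infinity_def intro!: cSUP_upper bdd_aboveI2)

lemma nrm_ell_infinity_le: "(\<And>i. \<bar>x i\<bar> \<le> b) \<Longrightarrow> nrm ell_infinity x \<le> b"
  by (auto simp: ell_infinity_def intro!: cSUP_least)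

lemma quasinormed_ell_infinity: "quasinormed ell_infinity"
proof
  show "(\<lambda>_. 0) \<in> vecs ell_infinity" by (auto simp: ell_infinity_in)
  fix x c assume x: "x \<in> vecs ell_infinity"
  then obtain b where b: "\<And>n. \<bar>x n\<bar> \<le> b" by (auto simp: ell_infinity_in)
  show sc: "(\<lambda>n. c * x n) \<in> vecs ell_infinity" for c
    using mult_left_mono[OF b, of "\<bar>c\<bar>"] by (auto simp: ell_infinity_in abs_mult)
  show nn: "0 \<le> nrm ell_infinity x"
    using abs_le_nrm_ell_infinity[OF x, of 0] by linarith
  have le: "nrm ell_infinity (\<lambda>n. c * x n) \<le> \<bar>c\<bar> * nrm ell_infinity x"
    by (intro nrm_ell_infinity_le) (auto simp: abs_mult intro!: mult_left_mono abs_le_nrm_ell_infinity x)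
  have ge: "\<bar>c\<bar> * nrm ell_infinity x \<le> nrm ell_infinity (\<lambda>n. c * x n)" if "c \<noteq> 0"
  proof -
    have "nrm ell_infinity x \<le> nrm ell_infinity (\<lambda>n. c * x n) / \<bar>c\<bar>"
      using abs_le_nrm_ell_infinity[OF sc, of c] that
      by (intro nrm_ell_infinity_le) (auto simp: abs_mult field_simps)
    then show ?thesis using that by (simp add: field_simps)
  qed
  show "nrm ell_infinity (\<lambda>n. c * x n) = \<bar>c\<bar> * nrm ell_infinity x"
    using le ge abs_le_nrm_ell_infinity[OF sc, of 0 0] by (cases "c = 0") auto
next
  fix x y assume x: "x \<in> vecs ell_infinity" and y: "y \<in> vecs ell_infinity"
  have *: "\<bar>x i + y i\<bar> \<le> nrm ell_infinity x + nrm ell_infinity y" for i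
    using abs_le_nrm_ell_infinity[OF x, of i] abs_le_nrm_ell_infinity[OF y, of i] by linarith
  then show "(\<lambda>n. x n + y n) \<in> vecs ell_infinity" by (auto simp: ell_infinity_in)
  have "nrm ell_infinity (\<lambda>n. x n + y n) \<le> nrm ell_infinity x + nrm ell_infinity y"
    by (intro nrm_ell_infinity_le *)
  also have "\<dots> \<le> 4 * (nrm ell_infinity x + nrm ell_infinity y)"
    using abs_le_nrm_ell_infinity[OF x, of 0] abs_le_nrm_ell_infinity[OF y, of 0]
      abs_ge_zero[of "x 0"] abs_ge_zero[of "y 0"] by argo
  finally show "nrm ell_infinity (\<lambda>n. x n + y n) \<le> 4 * (nrm ell_infinity x + nrm ell_infinity y)" .
qed

lemma lpn_le_nrm:
  assumes "0 < p" "x \<in> vecs (ell p)" "finite E"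
  shows "lpn p E x \<le> nrm (ell p) x"
  using assms unfolding lpn_def ell_simps
  by (intro powr_mono2 sum_le_suminf) (auto simp: sum_nonneg)

lemma nrm_cut:
  assumes "finite E"
  shows "cut E x \<in> vecs (ell p)" "nrm (ell p) (cut E x) = lpn p E x"
proof -
  have "(\<lambda>n. \<bar>cut E x n\<bar> powr p) sums (\<Sum>n\<in>E. \<bar>cut E x n\<bar> powr p)"
    using assms by (intro sums_finite) (auto simp: cut_def)
  also have "(\<Sum>n\<in>E. \<bar>cut E x n\<bar> powr p) = (\<Sum>n\<in>E. \<bar>x n\<bar> powr p)"
    by (intro sum.cong) (auto simp: cut_def)
  finally show "cut E x \<in> vecs (ell p)" "nrm (ell p) (cut E x) = lpn p E x"
    by (auto simp: sums_iff lpn_def)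
qed

lemma unit_vec_eq_cut: "unit_vec i = cut {i} (\<lambda>_. 1)"
  by (auto simp: unit_vec_def cut_def)

lemma unit_vec_in: "unit_vec i \<in> vecs (ell p)"
  unfolding unit_vec_eq_cut by (intro nrm_cut) simp

lemma nrm_unit_vec: "nrm (ell p) (unit_vec i) = 1"
  unfolding unit_vec_eq_cut by (subst nrm_cut) (simp_all add: lpn_def)

lemma operator_cut:
  assumes "T \<in> operators (ell p) Y" "1 \<le> p" "finite E"
  shows "T (cut E x) j = (\<Sum>i\<in>E. x i * T (unit_vec i) j)"
  using assms by (intro linear_cut[OF quasinormed_ell] unit_vec_in)
    (auto simp: operators_add[OF assms(1)] operators_scale[OF assms(1)])

text \<open>Hoelder for \<open>B (cut E x)\<close> against \<open>y\<close>. The matrix is recorded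
  together with its transpose, because the two parts of the theorem fix a line on different sides of
  it.\<close>

lemma operator_form_bound:
  assumes ab: "1 < a" "1 < b" "1 / a + 1 / b = 1" and B: "B \<in> operators (ell a) (ell a)"
  obtains C where "0 < C" "form_bound a b C (\<lambda>i j. B (unit_vec i) j)"
    "form_bound b a C (\<lambda>j i. B (unit_vec i) j)"
proof -
  obtain C where C: "0 < C" "\<And>x. x \<in> vecs (ell a) \<Longrightarrow> nrm (ell a) (B x) \<le> C * nrm (ell a) x"
    using operators_bound[OF B quasinormed_ell] ab by auto
  have le: "\<bar>\<Sum>j\<in>F. (\<Sum>i\<in>E. x i * B (unit_vec i) j) * y j\<bar> \<le> C * lpn a E x * lpn b F y"
    if E: "finite E" and F: "finite F" for E F x y
  proof -
    have "(\<Sum>j\<in>F. (\<Sum>i\<in>E. x i * B (unit_vec i) j) * y j) = (\<Sum>j\<in>F. B (cut E x) j * y j)"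
      using operator_cut[OF B _ E] ab by simp
    also have "\<bar>\<dots>\<bar> \<le> lpn a F (B (cut E x)) * lpn b F y"
      by (rule Holder_sum[OF ab F])
    also have "\<dots> \<le> (C * lpn a E x) * lpn b F y"
    proof (intro mult_right_mono lpn_nonneg)
      have "lpn a F (B (cut E x)) \<le> nrm (ell a) (B (cut E x))"
        using ab by (intro lpn_le_nrm operators_in[OF B] nrm_cut E F) auto
      also have "\<dots> \<le> C * lpn a E x"
        using C(2)[OF nrm_cut(1)[OF E]] by (simp only: nrm_cut(2)[OF E])
      finally show "lpn a F (B (cut E x)) \<le> C * lpn a E x" .
    qed
    finally show ?thesis .
  qed
  have "form_bound a b C (\<lambda>i j. B (unit_vec i) j)"
    unfolding form_bound_def
  proof (intro allI impI)
    fix E F :: "nat set" and x y assume "finite E" "finite F"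
    from le[OF this, of x y] show
      "\<bar>\<Sum>i\<in>E. \<Sum>j\<in>F. B (unit_vec i) j * x i * y j\<bar> \<le> C * lpn a E x * lpn b F y"
      by (subst sum.swap) (simp add: sum_distrib_right sum_distrib_left mult_ac)
  qed
  moreover have "form_bound b a C (\<lambda>j i. B (unit_vec i) j)"
    unfolding form_bound_def
  proof (intro allI impI)
    fix F E :: "nat set" and y x assume "finite F" "finite E"
    from le[OF this(2,1), of x y] show
      "\<bar>\<Sum>j\<in>F. \<Sum>i\<in>E. B (unit_vec i) j * y j * x i\<bar> \<le> C * lpn b F y * lpn a E x"
      by (simp only: sum_distrib_right sum_distrib_left mult_ac)
  qed
  ultimately show ?thesis using that C(1) by blast
qed

section \<open>Two families of closed ideals\<close>

definition lines_of :: "nat set \<Rightarrow> (nat \<times> nat \<times> nat) set" where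
  "lines_of M = (\<Union>m\<in>M. lines m)"

text \<open>The functional \<open>f_t\<close> of the overview; \<open>bump p t\<close> is its vector
  \<open>x_t\<close>. The exponent is \<open>- (1 / q)\<close> with \<open>q\<close> conjugate to
  \<open>p\<close>, which gives norm one on \<open>ell p\<close>.\<close>

definition line_avg :: "real \<Rightarrow> nat \<times> nat \<times> nat \<Rightarrow> (nat \<Rightarrow> real) \<Rightarrow> real" where
  "line_avg p t x = side (fst t) powr (- (1 - 1 / p)) * (\<Sum>i\<in>line t. x i)"

definition bump :: "real \<Rightarrow> nat \<times> nat \<times> nat \<Rightarrow> nat \<Rightarrow> real" where
  "bump p t = cut (line t) (\<lambda>_. side (fst t) powr (- (1 / p)))"

lemma lines_of_iff: "t \<in> lines_of M \<longleftrightarrow> fst t \<in> M \<and> t \<in> lines (fst t)"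
  by (auto simp: lines_of_def lines_def)

lemma lines_of_nonempty: "M \<noteq> {} \<Longrightarrow> lines_of M \<noteq> {}"
  using slopes_pos by (force simp: lines_of_def lines_def)

lemma bump_in: "bump p t \<in> vecs (ell p)"
  unfolding bump_def by (intro nrm_cut finite_line)

lemma nrm_bump: "0 < p \<Longrightarrow> nrm (ell p) (bump p t) = 1"
  unfolding bump_def by (subst nrm_cut) (simp_all only: finite_line lpn_line)

lemma line_avg_bump: "line_avg p t (bump p t) = 1"
proof -
  have s: "0 < real (side (fst t))" using side_pos by simp
  have "(\<Sum>i\<in>line t. bump p t i) = side (fst t) * side (fst t) powr (- (1 / p))"
    by (simp add: bump_def cut_def card_line)
  then have "line_avg p t (bump p t) =
      side (fst t) powr (- (1 - 1 / p)) * (side (fst t) powr 1 * side (fst t) powr (- (1 / p)))"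
    using s by (simp add: line_avg_def)
  also have "\<dots> = side (fst t) powr (- (1 - 1 / p) + (1 + - (1 / p)))"
    by (simp only: powr_add)
  also have "- (1 - 1 / p) + (1 + - (1 / p)) = 0" by simp
  finally show ?thesis using s by simp
qed

lemma line_avg_add: "line_avg p t (\<lambda>n. x n + y n) = line_avg p t x + line_avg p t y"
  by (simp add: line_avg_def sum.distrib algebra_simps)

lemma line_avg_scale: "line_avg p t (\<lambda>n. c * x n) = c * line_avg p t x"
  by (simp add: line_avg_def sum_distrib_left mult_ac)

lemma abs_line_avg_le:
  assumes p: "1 < p" and x: "x \<in> vecs (ell p)"
  shows "\<bar>line_avg p t x\<bar> \<le> nrm (ell p) x"
proof -
  define q where "q = 1 / (1 - 1 / p)"
  have q: "1 < q" "1 / p + 1 / q = 1" "1 / q = 1 - 1 / p" using p by (auto simp: q_def field_simps)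
  have "line_avg p t x = (\<Sum>i\<in>line t. x i * side (fst t) powr (- (1 / q)))"
    unfolding line_avg_def q(3) by (simp only: sum_distrib_left) (simp only: mult.commute)
  also have "\<bar>\<dots>\<bar> \<le> lpn p (line t) x * lpn q (line t) (\<lambda>_. side (fst t) powr (- (1 / q)))"
    by (rule Holder_sum[OF p q(1,2) finite_line])
  also have "\<dots> = lpn p (line t) x" using q by (subst lpn_line) auto
  also have "\<dots> \<le> nrm (ell p) x" using p x finite_line by (intro lpn_le_nrm) auto
  finally show ?thesis .
qed

text \<open>Clears the normalisations and leaves the block sum of the matrix over two lines, the
  quantity of the counting argument.\<close>

lemma line_avg_operator_bump:
  assumes p: "1 < p" and B: "B \<in> operators (ell p) (ell p)"
  shows "line_avg p t' (B (bump p t)) * (side (fst t) powr (1 / p) * side (fst t') powr (1 - 1 / p)) =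
    (\<Sum>i\<in>line t. \<Sum>j\<in>line t'. B (unit_vec i) j)"
proof -
  have s: "0 < real (side m)" for m using side_pos by simp
  have "line_avg p t' (B (bump p t)) = side (fst t') powr (- (1 - 1 / p)) *
      (\<Sum>j\<in>line t'. \<Sum>i\<in>line t. side (fst t) powr (- (1 / p)) * B (unit_vec i) j)"
    unfolding line_avg_def bump_def using operator_cut[OF B _ finite_line] p by simp
  also have "\<dots> = side (fst t') powr (- (1 - 1 / p)) * side (fst t) powr (- (1 / p)) *
      (\<Sum>i\<in>line t. \<Sum>j\<in>line t'. B (unit_vec i) j)"
    by (subst sum.swap) (simp add: sum_distrib_left mult.assoc)
  finally have "line_avg p t' (B (bump p t)) * (side (fst t) powr (1 / p) * side (fst t') powr (1 - 1 / p)) =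
      (side (fst t') powr (- (1 - 1 / p)) * side (fst t') powr (1 - 1 / p)) *
      (side (fst t) powr (- (1 / p)) * side (fst t) powr (1 / p)) *
      (\<Sum>i\<in>line t. \<Sum>j\<in>line t'. B (unit_vec i) j)"
    by (simp only: mult_ac)
  also have "side (fst t') powr (- (1 - 1 / p)) * side (fst t') powr (1 - 1 / p) = 1"
    using s[of "fst t'"] by (simp flip: powr_add)
  also have "side (fst t) powr (- (1 / p)) * side (fst t) powr (1 / p) = 1"
    using s[of "fst t"] by (simp flip: powr_add)
  finally show ?thesis by simp
qed

text \<open>\<open>S\<close> may be infinite, so the supremum is approached only up to an error. It
  is proportional to \<open>b\<close> because the errors in \<open>dominated\<close> and
  \<open>codominated\<close> scale with the norm.\<close>

lemma almost_max:
  fixes f :: "'a \<Rightarrow> real"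
  assumes "S \<noteq> {}" "\<And>t. t \<in> S \<Longrightarrow> \<bar>f t\<bar> \<le> b" "0 < \<epsilon>"
  shows "\<exists>t\<in>S. \<forall>t'\<in>S. \<bar>f t'\<bar> \<le> \<bar>f t\<bar> + \<epsilon> * b"
proof (cases "b > 0")
  case True
  have bdd: "bdd_above ((\<lambda>t. \<bar>f t\<bar>) ` S)" using assms by (auto intro!: bdd_aboveI2)
  have "(SUP t\<in>S. \<bar>f t\<bar>) - \<epsilon> * b < (SUP t\<in>S. \<bar>f t\<bar>)" using True assms by simp
  then obtain t where t: "t \<in> S" "(SUP t\<in>S. \<bar>f t\<bar>) - \<epsilon> * b < \<bar>f t\<bar>"
    using less_cSUP_iff[OF assms(1) bdd] by blast
  have "\<bar>f t'\<bar> \<le> \<bar>f t\<bar> + \<epsilon> * b" if "t' \<in> S" for t'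
    using cSUP_upper[OF that bdd] t by linarith
  with t(1) show ?thesis by blast
next
  case False
  have "f t = 0 \<and> b = 0" if "t \<in> S" for t using assms(2)[OF that] False by auto
  with assms(1) show ?thesis by auto
qed

text \<open>
  The defining inequality says that \<open>\<parallel>T x\<parallel>\<close> is at most \<open>K * \<parallel>U (B x)\<parallel> + \<epsilon> * \<parallel>x\<parallel>\<close>, where \<open>U\<close> has the line
  averages of the levels in \<open>M\<close> as its coordinates.  Since \<open>B\<close> may depend on \<open>x\<close> within a finite set,
  sums of operators are covered without factoring anything through \<open>\<ell>\<^sub>\<infinity>\<close>.
\<close>

definition dominated :: "real \<Rightarrow> nat set \<Rightarrow> ((nat \<Rightarrow> real) \<Rightarrow> (nat \<Rightarrow> real)) set" where
  "dominated p M = {T \<in> operators (ell p) ell_infinity. \<forall>\<epsilon>>0. \<exists>K\<ge>0. \<exists>\<B>. finite \<B> \<and>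
     \<B> \<subseteq> operators (ell p) (ell p) \<and>
     (\<forall>x\<in>vecs (ell p). \<exists>B\<in>\<B>. \<exists>t\<in>lines_of M.
        \<forall>i. \<bar>T x i\<bar> \<le> K * \<bar>line_avg p t (B x)\<bar> + \<epsilon> * nrm (ell p) x)}"

text \<open>The ball of radius \<open>b\<close> in the dual of \<open>ell p\<close>; carrying a
  bound \<open>b\<close> spares the dual norm.\<close>

definition functionals :: "real \<Rightarrow> real \<Rightarrow> ((nat \<Rightarrow> real) \<Rightarrow> real) set" where
  "functionals p b = {y. 0 \<le> b \<and>
     (\<forall>x\<in>vecs (ell p). \<forall>x'\<in>vecs (ell p). y (\<lambda>n. x n + x' n) = y x + y x') \<and>
     (\<forall>c. \<forall>x\<in>vecs (ell p). y (\<lambda>n. c * x n) = c * y x) \<and>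
     (\<forall>x\<in>vecs (ell p). \<bar>y x\<bar> \<le> b * nrm (ell p) x)}"

text \<open>
  The same inequality for the adjoint of \<open>T\<close>, written with functionals on \<open>\<ell>\<^sub>p\<close> so that no
  adjoint operators are needed.
\<close>

definition codominated :: "real \<Rightarrow> nat set \<Rightarrow> ((nat \<Rightarrow> real) \<Rightarrow> (nat \<Rightarrow> real)) set" where
  "codominated p M = {T \<in> operators (ell 1) (ell p). \<forall>\<epsilon>>0. \<exists>K\<ge>0. \<exists>\<B>. finite \<B> \<and>
     \<B> \<subseteq> operators (ell p) (ell p) \<and>
     (\<forall>b. \<forall>y\<in>functionals p b. \<exists>B\<in>\<B>. \<exists>t\<in>lines_of M. \<forall>z\<in>vecs (ell 1).
        \<bar>y (T z)\<bar> \<le> (K * \<bar>y (B (bump p t))\<bar> + \<epsilon> * b) * nrm (ell 1) z)}"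

section \<open>Closed ideals from the two domination inequalities\<close>

lemma dominatedD:
  assumes "T \<in> dominated p M" "0 < \<epsilon>"
  obtains K \<B> where "0 \<le> K" "finite \<B>" "\<B> \<subseteq> operators (ell p) (ell p)"
    "\<And>x. x \<in> vecs (ell p) \<Longrightarrow> \<exists>B\<in>\<B>. \<exists>t\<in>lines_of M.
      \<forall>i. \<bar>T x i\<bar> \<le> K * \<bar>line_avg p t (B x)\<bar> + \<epsilon> * nrm (ell p) x"
proof -
  from CollectD[OF assms(1)[unfolded dominated_def], THEN conjunct2, THEN spec, THEN mp, OF assms(2)]
  show thesis by (elim exE conjE) (rule that, assumption+, blast)
qed

lemma codominatedD:
  assumes "T \<in> codominated p M" "0 < \<epsilon>"
  obtains K \<B> where "0 \<le> K" "finite \<B>" "\<B> \<subseteq> operators (ell p) (ell p)"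
    "\<And>b y. y \<in> functionals p b \<Longrightarrow> \<exists>B\<in>\<B>. \<exists>t\<in>lines_of M. \<forall>z\<in>vecs (ell 1).
      \<bar>y (T z)\<bar> \<le> (K * \<bar>y (B (bump p t))\<bar> + \<epsilon> * b) * nrm (ell 1) z"
proof -
  from CollectD[OF assms(1)[unfolded codominated_def], THEN conjunct2, THEN spec, THEN mp, OF assms(2)]
  show thesis by (elim exE conjE) (rule that, assumption+, blast)
qed

lemma functionalsD:
  assumes "y \<in> functionals p b"
  shows "0 \<le> b"
    and "x \<in> vecs (ell p) \<Longrightarrow> x' \<in> vecs (ell p) \<Longrightarrow> y (\<lambda>n. x n + x' n) = y x + y x'"
    and "x \<in> vecs (ell p) \<Longrightarrow> y (\<lambda>n. c * x n) = c * y x"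
    and "x \<in> vecs (ell p) \<Longrightarrow> \<bar>y x\<bar> \<le> b * nrm (ell p) x"
  using assms unfolding functionals_def by blast+

text \<open>This is the adjoint of \<open>A\<close> applied to \<open>y\<close>, with its norm
  bound.\<close>

lemma functionals_comp:
  assumes y: "y \<in> functionals p b" and A: "A \<in> operators (ell p) (ell p)" and C: "0 \<le> C"
    and AC: "\<And>x. x \<in> vecs (ell p) \<Longrightarrow> nrm (ell p) (A x) \<le> C * nrm (ell p) x"
  shows "(\<lambda>x. y (A x)) \<in> functionals p (b * C)"
  unfolding functionals_def
proof (intro CollectI conjI ballI allI)
  note yD = functionalsD[OF y]
  show "0 \<le> b * C" using yD(1) C by simp
  fix x assume x: "x \<in> vecs (ell p)"
  note Ax = operators_in[OF A x]
  show "y (A (\<lambda>n. c * x n)) = c * y (A x)" for c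
    by (simp only: operators_scale[OF A x] yD(3)[OF Ax])
  show "y (A (\<lambda>n. x n + x' n)) = y (A x) + y (A x')" if x': "x' \<in> vecs (ell p)" for x'
    by (simp only: operators_add[OF A x x'] yD(2)[OF Ax operators_in[OF A x']])
  have "\<bar>y (A x)\<bar> \<le> b * nrm (ell p) (A x)" by (rule yD(4)[OF Ax])
  also have "\<dots> \<le> b * (C * nrm (ell p) x)" by (intro mult_left_mono AC x yD(1))
  finally show "\<bar>y (A x)\<bar> \<le> b * C * nrm (ell p) x" by (simp only: mult.assoc)
qed

text \<open>Behind closure under sums: the maximum is one of its two arguments, so one operator and
  one line still suffice for a sum.\<close>

lemma sum_le_max_domination:
  fixes K1 K2 u v :: real
  assumes "0 \<le> K1" "0 \<le> K2" "\<bar>s\<bar> \<le> K1 * u + e" "\<bar>t\<bar> \<le> K2 * v + e'"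
  shows "\<bar>s + t\<bar> \<le> (K1 + K2) * max u v + (e + e')"
proof -
  have "K1 * u \<le> K1 * max u v" "K2 * v \<le> K2 * max u v" using assms by (auto intro: mult_left_mono)
  then show ?thesis using assms by (auto simp: algebra_simps)
qed

lemma scaling_in: "quasinormed X \<Longrightarrow> (\<lambda>x\<in>vecs X. \<lambda>n. c * x n) \<in> operators X X"
  using op_scale_in[OF op_id_in, of X c] by (simp add: op_scale_def cong: restrict_cong)

text \<open>A sum unites the two finite families and adds the constants. In a product, the right
  factor is composed into the family, while the left one only enlarges \<open>K\<close>: the bound
  holds for all coordinates at once and thus bounds the norm of \<open>T x\<close>. Closedness comes
  from the slack \<open>\<epsilon>\<close>.\<close>

lemma closed_ideal_dominated:
  assumes p: "1 < p" and M: "M \<noteq> {}"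
  shows "closed_operator_ideal (ell p) ell_infinity (dominated p M)"
proof -
  let ?X = "ell p" and ?Y = ell_infinity
  have qX: "quasinormed ?X" using p by (intro quasinormed_ell) auto
  note qY = quasinormed_ell_infinity
  obtain t0 where t0: "t0 \<in> lines_of M" using lines_of_nonempty[OF M] by auto
  define I where "I = (\<lambda>x\<in>vecs ?X. x)"
  have I: "I \<in> operators ?X ?X" unfolding I_def by (rule op_id_in[OF qX])
  have nn: "0 \<le> nrm ?X x" for x by simp
  have op: "T \<in> operators ?X ?Y" if "T \<in> dominated p M" for T
    using that by (simp add: dominated_def)
  \<comment> \<open>\<open>K = 0\<close> works with any line; \<open>M \<noteq> {}\<close> provides
    one.\<close>
  have zero: "op_zero ?X \<in> dominated p M"
    unfolding dominated_def
  proof (intro CollectI conjI op_zero_in qX qY allI impI)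
    fix \<epsilon> :: real assume "0 < \<epsilon>"
    then have "\<bar>op_zero ?X x i\<bar> \<le> 0 * \<bar>line_avg p t0 (I x)\<bar> + \<epsilon> * nrm ?X x"
      if "x \<in> vecs ?X" for x i
      using that nn[of x] by (simp add: op_zero_def del: ell_simps)
    then show "\<exists>K\<ge>0. \<exists>\<B>. finite \<B> \<and> \<B> \<subseteq> operators ?X ?X \<and>
      (\<forall>x\<in>vecs ?X. \<exists>B\<in>\<B>. \<exists>t\<in>lines_of M.
        \<forall>i. \<bar>op_zero ?X x i\<bar> \<le> K * \<bar>line_avg p t (B x)\<bar> + \<epsilon> * nrm ?X x)"
      using t0 I by (intro exI[of _ 0] exI[of _ "{I}"] conjI ballI bexI[of _ I] bexI[of _ t0] allI)
        (simp_all del: ell_simps)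
  qed
  have add: "op_add ?X S T \<in> dominated p M" if S: "S \<in> dominated p M" and T: "T \<in> dominated p M" for S T
    unfolding dominated_def
  proof (intro CollectI conjI op_add_in op S T qX qY allI impI)
    fix \<epsilon> :: real assume \<epsilon>: "0 < \<epsilon>"
    obtain K1 \<B>1 where 1: "0 \<le> K1" "finite \<B>1" "\<B>1 \<subseteq> operators ?X ?X"
      "\<And>x. x \<in> vecs ?X \<Longrightarrow> \<exists>B\<in>\<B>1. \<exists>t\<in>lines_of M.
        \<forall>i. \<bar>S x i\<bar> \<le> K1 * \<bar>line_avg p t (B x)\<bar> + \<epsilon> / 2 * nrm ?X x"
      using dominatedD[OF S half_gt_zero[OF \<epsilon>]] by metis
    obtain K2 \<B>2 where 2: "0 \<le> K2" "finite \<B>2" "\<B>2 \<subseteq> operators ?X ?X"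
      "\<And>x. x \<in> vecs ?X \<Longrightarrow> \<exists>B\<in>\<B>2. \<exists>t\<in>lines_of M.
        \<forall>i. \<bar>T x i\<bar> \<le> K2 * \<bar>line_avg p t (B x)\<bar> + \<epsilon> / 2 * nrm ?X x"
      using dominatedD[OF T half_gt_zero[OF \<epsilon>]] by metis
    have "\<exists>B\<in>\<B>1 \<union> \<B>2. \<exists>t\<in>lines_of M.
      \<forall>i. \<bar>op_add ?X S T x i\<bar> \<le> (K1 + K2) * \<bar>line_avg p t (B x)\<bar> + \<epsilon> * nrm ?X x"
      if x: "x \<in> vecs ?X" for x
    proof -
      obtain B1 t1 where b1: "B1 \<in> \<B>1" "t1 \<in> lines_of M"
        "\<And>i. \<bar>S x i\<bar> \<le> K1 * \<bar>line_avg p t1 (B1 x)\<bar> + \<epsilon> / 2 * nrm ?X x" using 1(4)[OF x] by blast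
      obtain B2 t2 where b2: "B2 \<in> \<B>2" "t2 \<in> lines_of M"
        "\<And>i. \<bar>T x i\<bar> \<le> K2 * \<bar>line_avg p t2 (B2 x)\<bar> + \<epsilon> / 2 * nrm ?X x" using 2(4)[OF x] by blast
      have *: "\<bar>op_add ?X S T x i\<bar> \<le>
        (K1 + K2) * max \<bar>line_avg p t1 (B1 x)\<bar> \<bar>line_avg p t2 (B2 x)\<bar> + \<epsilon> * nrm ?X x" for i
        using sum_le_max_domination[OF 1(1) 2(1) b1(3)[of i] b2(3)[of i]] x
        by (simp add: op_add_def del: ell_simps)
      show ?thesis
      proof (cases "\<bar>line_avg p t1 (B1 x)\<bar> \<le> \<bar>line_avg p t2 (B2 x)\<bar>")
        case True
        then show ?thesis using * b2(1,2) unfolding max_absorb2[OF True] by blast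
      next
        case False
        then have "\<bar>line_avg p t2 (B2 x)\<bar> \<le> \<bar>line_avg p t1 (B1 x)\<bar>" by simp
        then show ?thesis using * b1(1,2) by (metis UnI1 max_absorb1)
      qed
    qed
    then show "\<exists>K\<ge>0. \<exists>\<B>. finite \<B> \<and> \<B> \<subseteq> operators ?X ?X \<and>
      (\<forall>x\<in>vecs ?X. \<exists>B\<in>\<B>. \<exists>t\<in>lines_of M.
        \<forall>i. \<bar>op_add ?X S T x i\<bar> \<le> K * \<bar>line_avg p t (B x)\<bar> + \<epsilon> * nrm ?X x)"
      using 1(1-3) 2(1-3) by (intro exI[of _ "K1 + K2"] exI[of _ "\<B>1 \<union> \<B>2"] conjI) auto
  qed
  have comp: "restrict (A \<circ> T \<circ> B0) (vecs ?X) \<in> dominated p M"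
    if A: "A \<in> operators ?Y ?Y" and T: "T \<in> dominated p M" and B0: "B0 \<in> operators ?X ?X" for A T B0
    unfolding dominated_def
  proof (intro CollectI conjI op_sandwich_in[OF A op[OF T] B0 qX qX qY] allI impI)
    fix \<epsilon> :: real assume \<epsilon>: "0 < \<epsilon>"
    obtain CA where CA: "0 < CA" "\<And>x. x \<in> vecs ?Y \<Longrightarrow> nrm ?Y (A x) \<le> CA * nrm ?Y x"
      using operators_bound[OF A qY] by blast
    obtain CB where CB: "0 < CB" "\<And>x. x \<in> vecs ?X \<Longrightarrow> nrm ?X (B0 x) \<le> CB * nrm ?X x"
      using operators_bound[OF B0 qX] by blast
    \<comment> \<open>Chosen so that the error is \<open>\<epsilon>\<close> again after passing
      through both outer operators.\<close>
    have \<epsilon>': "0 < \<epsilon> / (CA * CB)" using \<epsilon> CA CB by simp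
    obtain K \<B> where 1: "0 \<le> K" "finite \<B>" "\<B> \<subseteq> operators ?X ?X"
      "\<And>x. x \<in> vecs ?X \<Longrightarrow> \<exists>B\<in>\<B>. \<exists>t\<in>lines_of M.
        \<forall>i. \<bar>T x i\<bar> \<le> K * \<bar>line_avg p t (B x)\<bar> + \<epsilon> / (CA * CB) * nrm ?X x"
      using dominatedD[OF T \<epsilon>'] by metis
    define \<B>' where "\<B>' = (\<lambda>B. restrict (B \<circ> B0) (vecs ?X)) ` \<B>"
    have "\<exists>B\<in>\<B>'. \<exists>t\<in>lines_of M. \<forall>i. \<bar>restrict (A \<circ> T \<circ> B0) (vecs ?X) x i\<bar> \<le>
      (CA * K) * \<bar>line_avg p t (B x)\<bar> + \<epsilon> * nrm ?X x"
      if x: "x \<in> vecs ?X" for x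
    proof -
      note Bx = operators_in[OF B0 x]
      obtain B t where b: "B \<in> \<B>" "t \<in> lines_of M"
        "\<And>i. \<bar>T (B0 x) i\<bar> \<le> K * \<bar>line_avg p t (B (B0 x))\<bar> + \<epsilon> / (CA * CB) * nrm ?X (B0 x)"
        using 1(4)[OF Bx] by blast
      have "\<bar>A (T (B0 x)) i\<bar> \<le> (CA * K) * \<bar>line_avg p t (B (B0 x))\<bar> + \<epsilon> * nrm ?X x" for i
      proof -
        note TBx = operators_in[OF op[OF T] Bx]
        have "\<bar>A (T (B0 x)) i\<bar> \<le> nrm ?Y (A (T (B0 x)))"
          by (intro abs_le_nrm_ell_infinity operators_in[OF A] TBx)
        also have "\<dots> \<le> CA * nrm ?Y (T (B0 x))" by (rule CA(2)[OF TBx])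
        also have "\<dots> \<le> CA * (K * \<bar>line_avg p t (B (B0 x))\<bar> + \<epsilon> / (CA * CB) * nrm ?X (B0 x))"
          using CA(1) by (intro mult_left_mono nrm_ell_infinity_le b(3)) auto
        also have "\<dots> \<le> CA * (K * \<bar>line_avg p t (B (B0 x))\<bar> + \<epsilon> / (CA * CB) * (CB * nrm ?X x))"
          using CA(1) \<epsilon>' by (intro mult_left_mono add_left_mono CB(2) x) auto
        also have "\<dots> = (CA * K) * \<bar>line_avg p t (B (B0 x))\<bar> + \<epsilon> * nrm ?X x"
          using CA(1) CB(1) by (simp add: distrib_left del: ell_simps)
        finally show ?thesis .
      qed
      then show ?thesis using b(1,2) x unfolding \<B>'_def by (intro bexI[of _ "restrict (B \<circ> B0) (vecs ?X)"] bexI[of _ t]) (auto simp del: ell_simps)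
    qed
    moreover have "finite \<B>'" "\<B>' \<subseteq> operators ?X ?X"
      using 1(2,3) B0 qX by (auto simp: \<B>'_def intro!: op_comp_in)
    ultimately show "\<exists>K\<ge>0. \<exists>\<B>. finite \<B> \<and> \<B> \<subseteq> operators ?X ?X \<and>
      (\<forall>x\<in>vecs ?X. \<exists>B\<in>\<B>. \<exists>t\<in>lines_of M.
        \<forall>i. \<bar>restrict (A \<circ> T \<circ> B0) (vecs ?X) x i\<bar> \<le> K * \<bar>line_avg p t (B x)\<bar> + \<epsilon> * nrm ?X x)"
      using 1(1) CA(1) by (intro exI[of _ "CA * K"] exI[of _ \<B>'] conjI) auto
  qed
  \<comment> \<open>A multiple is a special product: a scaling on the left, the identity on the
    right.\<close>
  have scale: "op_scale ?X c T \<in> dominated p M" if T: "T \<in> dominated p M" for c T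
  proof -
    have "restrict ((\<lambda>x\<in>vecs ?Y. \<lambda>n. c * x n) \<circ> T \<circ> (\<lambda>x\<in>vecs ?X. x)) (vecs ?X) = op_scale ?X c T"
      using operators_in[OF op[OF T]] by (auto simp: op_scale_def fun_eq_iff simp del: ell_simps)
    then show ?thesis using comp[OF scaling_in[OF qY] T op_id_in[OF qX]] by metis
  qed
  have closed: "T \<in> dominated p M"
    if S: "\<And>k. S k \<in> dominated p M" and T: "T \<in> operators ?X ?Y"
      and lim: "(\<lambda>k. opnorm ?X ?Y (op_diff ?X (S k) T)) \<longlonglongrightarrow> 0" for S T
    unfolding dominated_def
  proof (intro CollectI conjI T allI impI)
    fix \<epsilon> :: real assume \<epsilon>: "0 < \<epsilon>"
    have "\<forall>\<^sub>F k in sequentially. opnorm ?X ?Y (op_diff ?X (S k) T) < \<epsilon> / 2"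
      using lim \<epsilon> by (intro order_tendstoD(2)) auto
    \<comment> \<open>Half of the error comes from the approximant \<open>S k\<close>, the other
      half from its distance to \<open>T\<close>.\<close>
    then obtain k where k: "opnorm ?X ?Y (op_diff ?X (S k) T) < \<epsilon> / 2"
      using eventually_happens'[OF sequentially_bot] by blast
    have D: "op_diff ?X (S k) T \<in> operators ?X ?Y" by (intro op_diff_in op S T qX qY)
    obtain K \<B> where 1: "0 \<le> K" "finite \<B>" "\<B> \<subseteq> operators ?X ?X"
      "\<And>x. x \<in> vecs ?X \<Longrightarrow> \<exists>B\<in>\<B>. \<exists>t\<in>lines_of M.
        \<forall>i. \<bar>S k x i\<bar> \<le> K * \<bar>line_avg p t (B x)\<bar> + \<epsilon> / 2 * nrm ?X x"
      using dominatedD[OF S[of k] half_gt_zero[OF \<epsilon>]] by metis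
    have "\<exists>B\<in>\<B>. \<exists>t\<in>lines_of M. \<forall>i. \<bar>T x i\<bar> \<le> K * \<bar>line_avg p t (B x)\<bar> + \<epsilon> * nrm ?X x"
      if x: "x \<in> vecs ?X" for x
    proof -
      obtain B t where b: "B \<in> \<B>" "t \<in> lines_of M"
        "\<And>i. \<bar>S k x i\<bar> \<le> K * \<bar>line_avg p t (B x)\<bar> + \<epsilon> / 2 * nrm ?X x" using 1(4)[OF x] by blast
      have "\<bar>T x i\<bar> \<le> K * \<bar>line_avg p t (B x)\<bar> + \<epsilon> * nrm ?X x" for i
      proof -
        have "\<bar>S k x i - T x i\<bar> = \<bar>op_diff ?X (S k) T x i\<bar>" using x by (simp add: op_diff_def)
        also have "\<dots> \<le> nrm ?Y (op_diff ?X (S k) T x)"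
          by (intro abs_le_nrm_ell_infinity operators_in[OF D] x)
        also have "\<dots> \<le> opnorm ?X ?Y (op_diff ?X (S k) T) * nrm ?X x"
          by (rule nrm_le_opnorm[OF D qX qY x])
        also have "\<dots> \<le> \<epsilon> / 2 * nrm ?X x" using k by (intro mult_right_mono nn) simp
        finally have "\<bar>S k x i - T x i\<bar> \<le> \<epsilon> / 2 * nrm ?X x" .
        moreover have "\<epsilon> * nrm ?X x = \<epsilon> / 2 * nrm ?X x + \<epsilon> / 2 * nrm ?X x" by simp
        ultimately show ?thesis using b(3)[of i] by linarith
      qed
      with b show ?thesis by blast
    qed
    then show "\<exists>K\<ge>0. \<exists>\<B>. finite \<B> \<and> \<B> \<subseteq> operators ?X ?X \<and>
      (\<forall>x\<in>vecs ?X. \<exists>B\<in>\<B>. \<exists>t\<in>lines_of M.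
        \<forall>i. \<bar>T x i\<bar> \<le> K * \<bar>line_avg p t (B x)\<bar> + \<epsilon> * nrm ?X x)"
      using 1(1-3) by (intro exI[of _ K] exI[of _ \<B>] conjI) auto
  qed
  show ?thesis
    unfolding closed_operator_ideal_def operator_ideal_def
    using op zero add scale comp closed by blast
qed

text \<open>As for \<open>dominated\<close> with the sides exchanged: the left factor passes through
  the functional into the family, and the right factor only enlarges \<open>K\<close>.\<close>

lemma closed_ideal_codominated:
  assumes p: "1 < p" and M: "M \<noteq> {}"
  shows "closed_operator_ideal (ell 1) (ell p) (codominated p M)"
proof -
  let ?X = "ell 1" and ?Y = "ell p"
  have qX: "quasinormed ?X" by (intro quasinormed_ell) auto
  have qY: "quasinormed ?Y" using p by (intro quasinormed_ell) auto
  obtain t0 where t0: "t0 \<in> lines_of M" using lines_of_nonempty[OF M] by auto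
  define I where "I = (\<lambda>x\<in>vecs ?Y. x)"
  have I: "I \<in> operators ?Y ?Y" unfolding I_def by (rule op_id_in[OF qY])
  have nn: "0 \<le> nrm ?X x" for x by (simp only: ell_simps powr_ge_zero)
  have op: "T \<in> operators ?X ?Y" if "T \<in> codominated p M" for T
    using that by (simp add: codominated_def)
  have zero: "op_zero ?X \<in> codominated p M"
    unfolding codominated_def
  proof (intro CollectI conjI op_zero_in qX qY allI impI)
    fix \<epsilon> :: real assume \<epsilon>: "0 < \<epsilon>"
    have "\<bar>y (op_zero ?X z)\<bar> \<le> (0 * \<bar>y (I (bump p t0))\<bar> + \<epsilon> * b) * nrm ?X z"
      if y: "y \<in> functionals p b" and z: "z \<in> vecs ?X" for y z b
    proof -
      have "y (op_zero ?X z) = 0"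
        using functionalsD(3)[OF y quasinormed.zero_in[OF qY], of 0] z
        by (simp add: op_zero_def del: ell_simps)
      then show ?thesis using \<epsilon> functionalsD(1)[OF y] nn[of z] by (simp del: ell_simps)
    qed
    then show "\<exists>K\<ge>0. \<exists>\<B>. finite \<B> \<and> \<B> \<subseteq> operators ?Y ?Y \<and>
      (\<forall>b. \<forall>y\<in>functionals p b. \<exists>B\<in>\<B>. \<exists>t\<in>lines_of M. \<forall>z\<in>vecs ?X.
        \<bar>y (op_zero ?X z)\<bar> \<le> (K * \<bar>y (B (bump p t))\<bar> + \<epsilon> * b) * nrm ?X z)"
      using t0 I by (intro exI[of _ 0] exI[of _ "{I}"] conjI ballI bexI[of _ I] bexI[of _ t0] allI)
        (simp_all del: ell_simps)
  qed
  have add: "op_add ?X S T \<in> codominated p M"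
    if S: "S \<in> codominated p M" and T: "T \<in> codominated p M" for S T
    unfolding codominated_def
  proof (intro CollectI conjI op_add_in op S T qX qY allI impI)
    fix \<epsilon> :: real assume \<epsilon>: "0 < \<epsilon>"
    obtain K1 \<B>1 where 1: "0 \<le> K1" "finite \<B>1" "\<B>1 \<subseteq> operators ?Y ?Y"
      "\<And>b y. y \<in> functionals p b \<Longrightarrow> \<exists>B\<in>\<B>1. \<exists>t\<in>lines_of M. \<forall>z\<in>vecs ?X.
        \<bar>y (S z)\<bar> \<le> (K1 * \<bar>y (B (bump p t))\<bar> + \<epsilon> / 2 * b) * nrm ?X z"
      using codominatedD[OF S half_gt_zero[OF \<epsilon>]] by metis
    obtain K2 \<B>2 where 2: "0 \<le> K2" "finite \<B>2" "\<B>2 \<subseteq> operators ?Y ?Y"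
      "\<And>b y. y \<in> functionals p b \<Longrightarrow> \<exists>B\<in>\<B>2. \<exists>t\<in>lines_of M. \<forall>z\<in>vecs ?X.
        \<bar>y (T z)\<bar> \<le> (K2 * \<bar>y (B (bump p t))\<bar> + \<epsilon> / 2 * b) * nrm ?X z"
      using codominatedD[OF T half_gt_zero[OF \<epsilon>]] by metis
    have "\<exists>B\<in>\<B>1 \<union> \<B>2. \<exists>t\<in>lines_of M. \<forall>z\<in>vecs ?X.
      \<bar>y (op_add ?X S T z)\<bar> \<le> ((K1 + K2) * \<bar>y (B (bump p t))\<bar> + \<epsilon> * b) * nrm ?X z"
      if y: "y \<in> functionals p b" for y b
    proof -
      obtain B1 t1 where b1: "B1 \<in> \<B>1" "t1 \<in> lines_of M" "\<And>z. z \<in> vecs ?X \<Longrightarrow>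
        \<bar>y (S z)\<bar> \<le> (K1 * \<bar>y (B1 (bump p t1))\<bar> + \<epsilon> / 2 * b) * nrm ?X z" using 1(4)[OF y] by blast
      obtain B2 t2 where b2: "B2 \<in> \<B>2" "t2 \<in> lines_of M" "\<And>z. z \<in> vecs ?X \<Longrightarrow>
        \<bar>y (T z)\<bar> \<le> (K2 * \<bar>y (B2 (bump p t2))\<bar> + \<epsilon> / 2 * b) * nrm ?X z" using 2(4)[OF y] by blast
      have *: "\<bar>y (op_add ?X S T z)\<bar> \<le>
        ((K1 + K2) * max \<bar>y (B1 (bump p t1))\<bar> \<bar>y (B2 (bump p t2))\<bar> + \<epsilon> * b) * nrm ?X z"
        if z: "z \<in> vecs ?X" for z
      proof -
        have yy: "y (op_add ?X S T z) = y (S z) + y (T z)"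
          using functionalsD(2)[OF y operators_in[OF op[OF S] z] operators_in[OF op[OF T] z]] z
          by (simp only: op_add_def restrict_apply if_True)
        have "\<bar>y (S z)\<bar> \<le> K1 * (\<bar>y (B1 (bump p t1))\<bar> * nrm ?X z) + \<epsilon> / 2 * b * nrm ?X z"
          using b1(3)[OF z] by (simp only: distrib_right mult.assoc)
        moreover have "\<bar>y (T z)\<bar> \<le> K2 * (\<bar>y (B2 (bump p t2))\<bar> * nrm ?X z) + \<epsilon> / 2 * b * nrm ?X z"
          using b2(3)[OF z] by (simp only: distrib_right mult.assoc)
        ultimately have "\<bar>y (S z) + y (T z)\<bar> \<le> (K1 + K2) *
            max (\<bar>y (B1 (bump p t1))\<bar> * nrm ?X z) (\<bar>y (B2 (bump p t2))\<bar> * nrm ?X z) +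
            (\<epsilon> / 2 * b * nrm ?X z + \<epsilon> / 2 * b * nrm ?X z)"
          by (intro sum_le_max_domination 1(1) 2(1))
        \<comment> \<open>The factor depending on \<open>z\<close> is pulled out of the maximum,
          because the operator and the line have to be chosen before \<open>z\<close>.\<close>
        also have "max (\<bar>y (B1 (bump p t1))\<bar> * nrm ?X z) (\<bar>y (B2 (bump p t2))\<bar> * nrm ?X z) =
            max \<bar>y (B1 (bump p t1))\<bar> \<bar>y (B2 (bump p t2))\<bar> * nrm ?X z"
          using max_mult_distrib_right[of "\<bar>y (B1 (bump p t1))\<bar>" "\<bar>y (B2 (bump p t2))\<bar>" "nrm ?X z"] nn[of z]
          by (simp del: ell_simps)
        finally show ?thesis unfolding yy by (simp add: algebra_simps del: ell_simps)
      qed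
      show ?thesis
      proof (cases "\<bar>y (B1 (bump p t1))\<bar> \<le> \<bar>y (B2 (bump p t2))\<bar>")
        case True
        then show ?thesis using * b2(1,2) unfolding max_absorb2[OF True] by blast
      next
        case False
        then have le: "\<bar>y (B2 (bump p t2))\<bar> \<le> \<bar>y (B1 (bump p t1))\<bar>" by simp
        then show ?thesis using * b1(1,2) unfolding max_absorb1[OF le] by blast
      qed
    qed
    then show "\<exists>K\<ge>0. \<exists>\<B>. finite \<B> \<and> \<B> \<subseteq> operators ?Y ?Y \<and>
      (\<forall>b. \<forall>y\<in>functionals p b. \<exists>B\<in>\<B>. \<exists>t\<in>lines_of M. \<forall>z\<in>vecs ?X.
        \<bar>y (op_add ?X S T z)\<bar> \<le> (K * \<bar>y (B (bump p t))\<bar> + \<epsilon> * b) * nrm ?X z)"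
      using 1(1-3) 2(1-3) by (intro exI[of _ "K1 + K2"] exI[of _ "\<B>1 \<union> \<B>2"] conjI) (blast | simp)+
  qed
  have comp: "restrict (A \<circ> T \<circ> B0) (vecs ?X) \<in> codominated p M"
    if A: "A \<in> operators ?Y ?Y" and T: "T \<in> codominated p M" and B0: "B0 \<in> operators ?X ?X" for A T B0
    unfolding codominated_def
  proof (intro CollectI conjI op_sandwich_in[OF A op[OF T] B0 qX qX qY] allI impI)
    fix \<epsilon> :: real assume \<epsilon>: "0 < \<epsilon>"
    obtain CA where CA: "0 < CA" "\<And>x. x \<in> vecs ?Y \<Longrightarrow> nrm ?Y (A x) \<le> CA * nrm ?Y x"
      using operators_bound[OF A qY] by blast
    obtain CB where CB: "0 < CB" "\<And>x. x \<in> vecs ?X \<Longrightarrow> nrm ?X (B0 x) \<le> CB * nrm ?X x"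
      using operators_bound[OF B0 qX] by blast
    have \<epsilon>': "0 < \<epsilon> / (CA * CB)" using \<epsilon> CA CB by simp
    obtain K \<B> where 1: "0 \<le> K" "finite \<B>" "\<B> \<subseteq> operators ?Y ?Y"
      "\<And>b y. y \<in> functionals p b \<Longrightarrow> \<exists>B\<in>\<B>. \<exists>t\<in>lines_of M. \<forall>z\<in>vecs ?X.
        \<bar>y (T z)\<bar> \<le> (K * \<bar>y (B (bump p t))\<bar> + \<epsilon> / (CA * CB) * b) * nrm ?X z"
      using codominatedD[OF T \<epsilon>'] by metis
    define \<B>' where "\<B>' = (\<lambda>B. restrict (A \<circ> B) (vecs ?Y)) ` \<B>"
    have "\<exists>B\<in>\<B>'. \<exists>t\<in>lines_of M. \<forall>z\<in>vecs ?X. \<bar>y (restrict (A \<circ> T \<circ> B0) (vecs ?X) z)\<bar> \<le>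
      ((CB * K) * \<bar>y (B (bump p t))\<bar> + \<epsilon> * b) * nrm ?X z"
      if y: "y \<in> functionals p b" for y b
    proof -
      \<comment> \<open>Testing \<open>A\<close> after \<open>T\<close> with \<open>y\<close> is
        testing \<open>T\<close> with \<open>y\<close> after \<open>A\<close>; a member
        \<open>B\<close> of the family for \<open>T\<close> turns into \<open>A\<close> after
        \<open>B\<close>.\<close>
      have yA: "(\<lambda>x. y (A x)) \<in> functionals p (b * CA)"
        using CA by (intro functionals_comp[OF y A]) (auto simp del: ell_simps)
      obtain B t where b: "B \<in> \<B>" "t \<in> lines_of M" "\<And>z. z \<in> vecs ?X \<Longrightarrow>
        \<bar>y (A (T z))\<bar> \<le> (K * \<bar>y (A (B (bump p t)))\<bar> + \<epsilon> / (CA * CB) * (b * CA)) * nrm ?X z"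
        using 1(4)[OF yA] by blast
      have nnK: "0 \<le> K * \<bar>y (A (B (bump p t)))\<bar> + \<epsilon> / (CA * CB) * (b * CA)"
        using 1(1) \<epsilon>' CA(1) functionalsD(1)[OF y] by (intro add_nonneg_nonneg mult_nonneg_nonneg) auto
      have "\<bar>y (A (T (B0 z)))\<bar> \<le> ((CB * K) * \<bar>y (A (B (bump p t)))\<bar> + \<epsilon> * b) * nrm ?X z"
        if z: "z \<in> vecs ?X" for z
      proof -
        have "\<bar>y (A (T (B0 z)))\<bar> \<le>
            (K * \<bar>y (A (B (bump p t)))\<bar> + \<epsilon> / (CA * CB) * (b * CA)) * nrm ?X (B0 z)"
          by (rule b(3)[OF operators_in[OF B0 z]])
        also have "\<dots> \<le> (K * \<bar>y (A (B (bump p t)))\<bar> + \<epsilon> / (CA * CB) * (b * CA)) * (CB * nrm ?X z)"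
          by (intro mult_left_mono CB(2) z nnK)
        also have "\<dots> = ((CB * K) * \<bar>y (A (B (bump p t)))\<bar> + \<epsilon> * b) * nrm ?X z"
          using CA(1) CB(1) by (simp add: field_simps del: ell_simps)
        finally show ?thesis .
      qed
      then show ?thesis using b(1,2) bump_in[of p t] unfolding \<B>'_def
        by (intro bexI[of _ "restrict (A \<circ> B) (vecs ?Y)"] bexI[of _ t]) (auto simp del: ell_simps)
    qed
    moreover have "finite \<B>'" "\<B>' \<subseteq> operators ?Y ?Y"
      using 1(2,3) A qY by (auto simp: \<B>'_def intro!: op_comp_in)
    ultimately show "\<exists>K\<ge>0. \<exists>\<B>. finite \<B> \<and> \<B> \<subseteq> operators ?Y ?Y \<and>
      (\<forall>b. \<forall>y\<in>functionals p b. \<exists>B\<in>\<B>. \<exists>t\<in>lines_of M. \<forall>z\<in>vecs ?X.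
        \<bar>y (restrict (A \<circ> T \<circ> B0) (vecs ?X) z)\<bar> \<le> (K * \<bar>y (B (bump p t))\<bar> + \<epsilon> * b) * nrm ?X z)"
      using 1(1) CB(1) by (intro exI[of _ "CB * K"] exI[of _ \<B>'] conjI) (blast | simp)+
  qed
  have scale: "op_scale ?X c T \<in> codominated p M" if T: "T \<in> codominated p M" for c T
  proof -
    have "restrict ((\<lambda>x\<in>vecs ?Y. \<lambda>n. c * x n) \<circ> T \<circ> (\<lambda>x\<in>vecs ?X. x)) (vecs ?X) = op_scale ?X c T"
      using operators_in[OF op[OF T]] by (auto simp: op_scale_def fun_eq_iff simp del: ell_simps)
    then show ?thesis using comp[OF scaling_in[OF qY] T op_id_in[OF qX]] by metis
  qed
  have closed: "T \<in> codominated p M"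
    if S: "\<And>k. S k \<in> codominated p M" and T: "T \<in> operators ?X ?Y"
      and lim: "(\<lambda>k. opnorm ?X ?Y (op_diff ?X (S k) T)) \<longlonglongrightarrow> 0" for S T
    unfolding codominated_def
  proof (intro CollectI conjI T allI impI)
    fix \<epsilon> :: real assume \<epsilon>: "0 < \<epsilon>"
    have "\<forall>\<^sub>F k in sequentially. opnorm ?X ?Y (op_diff ?X (S k) T) < \<epsilon> / 2"
      using lim \<epsilon> by (intro order_tendstoD(2)) auto
    then obtain k where k: "opnorm ?X ?Y (op_diff ?X (S k) T) < \<epsilon> / 2"
      using eventually_happens'[OF sequentially_bot] by blast
    have D: "op_diff ?X (S k) T \<in> operators ?X ?Y" by (intro op_diff_in op S T qX qY)
    obtain K \<B> where 1: "0 \<le> K" "finite \<B>" "\<B> \<subseteq> operators ?Y ?Y"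
      "\<And>b y. y \<in> functionals p b \<Longrightarrow> \<exists>B\<in>\<B>. \<exists>t\<in>lines_of M. \<forall>z\<in>vecs ?X.
        \<bar>y (S k z)\<bar> \<le> (K * \<bar>y (B (bump p t))\<bar> + \<epsilon> / 2 * b) * nrm ?X z"
      using codominatedD[OF S[of k] half_gt_zero[OF \<epsilon>]] by metis
    have "\<exists>B\<in>\<B>. \<exists>t\<in>lines_of M. \<forall>z\<in>vecs ?X.
      \<bar>y (T z)\<bar> \<le> (K * \<bar>y (B (bump p t))\<bar> + \<epsilon> * b) * nrm ?X z"
      if y: "y \<in> functionals p b" for y b
    proof -
      obtain B t where b: "B \<in> \<B>" "t \<in> lines_of M" "\<And>z. z \<in> vecs ?X \<Longrightarrow>
        \<bar>y (S k z)\<bar> \<le> (K * \<bar>y (B (bump p t))\<bar> + \<epsilon> / 2 * b) * nrm ?X z" using 1(4)[OF y] by blast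
      have "\<bar>y (T z)\<bar> \<le> (K * \<bar>y (B (bump p t))\<bar> + \<epsilon> * b) * nrm ?X z" if z: "z \<in> vecs ?X" for z
      proof -
        \<comment> \<open>The difference is written as a sum with \<open>- 1 * T z n\<close>, so
          that additivity and homogeneity of \<open>y\<close> apply.\<close>
        have "(\<lambda>n. S k z n + - 1 * T z n) = op_diff ?X (S k) T z" using z by (simp add: op_diff_def)
        then have yd: "y (op_diff ?X (S k) T z) = y (S k z) - y (T z)"
          using functionalsD(2)[OF y operators_in[OF op[OF S] z]
              quasinormed.scale_in[OF qY operators_in[OF T z]], of k "-1"]
            functionalsD(3)[OF y operators_in[OF T z], of "-1"] by simp
        have "\<bar>y (op_diff ?X (S k) T z)\<bar> \<le> b * nrm ?Y (op_diff ?X (S k) T z)"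
          by (intro functionalsD(4)[OF y] operators_in[OF D] z)
        also have "\<dots> \<le> b * (opnorm ?X ?Y (op_diff ?X (S k) T) * nrm ?X z)"
          by (intro mult_left_mono nrm_le_opnorm[OF D qX qY z] functionalsD(1)[OF y])
        also have "\<dots> \<le> b * (\<epsilon> / 2 * nrm ?X z)"
          using k by (intro mult_left_mono mult_right_mono nn functionalsD(1)[OF y]) simp
        finally have "\<bar>y (S k z) - y (T z)\<bar> \<le> b * (\<epsilon> / 2 * nrm ?X z)" unfolding yd .
        moreover have "(K * \<bar>y (B (bump p t))\<bar> + \<epsilon> * b) * nrm ?X z =
            (K * \<bar>y (B (bump p t))\<bar> + \<epsilon> / 2 * b) * nrm ?X z + b * (\<epsilon> / 2 * nrm ?X z)"
          by (simp add: field_simps del: ell_simps)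
        ultimately show ?thesis using b(3)[OF z] by linarith
      qed
      with b show ?thesis by blast
    qed
    then show "\<exists>K\<ge>0. \<exists>\<B>. finite \<B> \<and> \<B> \<subseteq> operators ?Y ?Y \<and>
      (\<forall>b. \<forall>y\<in>functionals p b. \<exists>B\<in>\<B>. \<exists>t\<in>lines_of M. \<forall>z\<in>vecs ?X.
        \<bar>y (T z)\<bar> \<le> (K * \<bar>y (B (bump p t))\<bar> + \<epsilon> * b) * nrm ?X z)"
      using 1(1-3) by (intro exI[of _ K] exI[of _ \<B>] conjI) (blast | simp)+
  qed
  show ?thesis
    unfolding closed_operator_ideal_def operator_ideal_def
    using op zero add scale comp closed by blast
qed

section \<open>Separation of the ideals\<close>

lemma uniform_form_bound:
  assumes ab: "1 < a" "1 < b" "1 / a + 1 / b = 1"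
    and \<B>: "finite \<B>" "\<B> \<subseteq> operators (ell a) (ell a)"
  shows "\<exists>C\<ge>0. \<forall>B\<in>\<B>. form_bound a b C (\<lambda>i j. B (unit_vec i) j) \<and>
    form_bound b a C (\<lambda>j i. B (unit_vec i) j)"
proof -
  have mono: "form_bound a b C' \<beta>" if "form_bound a b C \<beta>" "C \<le> C'" for a b C C' \<beta>
    unfolding form_bound_def
  proof (intro allI impI)
    fix E F :: "nat set" and x y assume "finite E" "finite F"
    with that(1) have "\<bar>\<Sum>i\<in>E. \<Sum>j\<in>F. \<beta> i j * x i * y j\<bar> \<le> C * lpn a E x * lpn b F y"
      by (rule form_boundD)
    also have "\<dots> \<le> C' * lpn a E x * lpn b F y"
      by (intro mult_right_mono that(2) lpn_nonneg)
    finally show "\<bar>\<Sum>i\<in>E. \<Sum>j\<in>F. \<beta> i j * x i * y j\<bar> \<le> C' * lpn a E x * lpn b F y" .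
  qed
  have "\<forall>B\<in>\<B>. \<exists>C>0. form_bound a b C (\<lambda>i j. B (unit_vec i) j) \<and>
    form_bound b a C (\<lambda>j i. B (unit_vec i) j)"
  proof
    fix B assume "B \<in> \<B>"
    then have "B \<in> operators (ell a) (ell a)" using \<B> by blast
    from operator_form_bound[OF ab this] show "\<exists>C>0. form_bound a b C (\<lambda>i j. B (unit_vec i) j) \<and>
      form_bound b a C (\<lambda>j i. B (unit_vec i) j)" by blast
  qed
  from bchoice[OF this] obtain c where "\<forall>B\<in>\<B>. 0 < c B \<and> form_bound a b (c B) (\<lambda>i j. B (unit_vec i) j) \<and>
    form_bound b a (c B) (\<lambda>j i. B (unit_vec i) j)" ..
  note c = this[rule_format]
  have le: "c B \<le> sum c \<B>" if "B \<in> \<B>" for B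
    using c that \<B>(1) by (intro member_le_sum) (auto intro: less_imp_le)
  show ?thesis
  proof (intro exI[of _ "sum c \<B>"] conjI ballI)
    show "0 \<le> sum c \<B>" using c by (intro sum_nonneg) (auto intro: less_imp_le)
    fix B assume B: "B \<in> \<B>"
    show "form_bound a b (sum c \<B>) (\<lambda>i j. B (unit_vec i) j)"
      "form_bound b a (sum c \<B>) (\<lambda>j i. B (unit_vec i) j)"
      using c[OF B] by (auto intro: mono[OF _ le[OF B]])
  qed
qed

section \<open>Operators of line averages: membership and separation\<close>

definition avg_op :: "real \<Rightarrow> nat set \<Rightarrow> (nat \<Rightarrow> real) \<Rightarrow> nat \<Rightarrow> real" where
  "avg_op p M = (\<lambda>x\<in>vecs (ell p). \<lambda>i. if from_nat i \<in> lines_of M then line_avg p (from_nat i) x else 0)"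

text \<open>The identity alone serves as the family, with \<open>K = 1\<close>: a line whose average
  at \<open>x\<close> is maximal up to \<open>\<epsilon> * nrm (ell p) x\<close> bounds all
  coordinates. Several indices may decode to the same line under \<open>from_nat\<close>, which a
  supremum does not notice.\<close>

lemma avg_op_dominated:
  assumes p: "1 < p" and M: "M \<noteq> {}"
  shows "avg_op p M \<in> dominated p M"
proof -
  have q: "quasinormed (ell p)" using p by (intro quasinormed_ell) auto
  have nn: "0 \<le> nrm (ell p) x" for x by (simp only: ell_simps powr_ge_zero)
  have le: "\<bar>if from_nat i \<in> lines_of M then line_avg p (from_nat i) x else 0\<bar> \<le> nrm (ell p) x"
    if "x \<in> vecs (ell p)" for x i
    using abs_line_avg_le[OF p that] nn[of x] by (simp del: ell_simps)
  have op: "avg_op p M \<in> operators (ell p) ell_infinity"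
    unfolding avg_op_def
  proof (intro restrict_operatorI[where C = 1] q)
    fix x assume x: "x \<in> vecs (ell p)"
    show "(\<lambda>i. if from_nat i \<in> lines_of M then line_avg p (from_nat i) x else 0) \<in> vecs ell_infinity"
      unfolding ell_infinity_in using le[OF x] by blast
    show "nrm ell_infinity (\<lambda>i. if from_nat i \<in> lines_of M then line_avg p (from_nat i) x else 0)
      \<le> 1 * nrm (ell p) x"
      unfolding mult_1 by (intro nrm_ell_infinity_le le x)
  qed (auto simp: fun_eq_iff line_avg_add line_avg_scale)
  define I where "I = (\<lambda>x\<in>vecs (ell p). x)"
  have I: "I \<in> operators (ell p) (ell p)" unfolding I_def by (rule op_id_in[OF q])
  have "\<exists>t\<in>lines_of M. \<forall>i. \<bar>avg_op p M x i\<bar> \<le> 1 * \<bar>line_avg p t (I x)\<bar> + \<epsilon> * nrm (ell p) x"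
    if \<epsilon>: "0 < \<epsilon>" and x: "x \<in> vecs (ell p)" for \<epsilon> x
  proof -
    obtain t where t: "t \<in> lines_of M"
      "\<And>t'. t' \<in> lines_of M \<Longrightarrow> \<bar>line_avg p t' x\<bar> \<le> \<bar>line_avg p t x\<bar> + \<epsilon> * nrm (ell p) x"
      using almost_max[OF lines_of_nonempty[OF M], of "\<lambda>t. line_avg p t x" "nrm (ell p) x" \<epsilon>]
        abs_line_avg_le[OF p x] \<epsilon> by blast
    have "\<bar>avg_op p M x i\<bar> \<le> 1 * \<bar>line_avg p t (I x)\<bar> + \<epsilon> * nrm (ell p) x" for i
      using x t(2)[of "from_nat i"] \<epsilon> nn[of x] by (auto simp: avg_op_def I_def simp del: ell_simps)
    with t(1) show ?thesis by blast
  qed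
  then show ?thesis unfolding dominated_def using op I
    by (intro CollectI conjI allI impI exI[of _ 1] exI[of _ "{I}"] ballI bexI[of _ I]) (simp_all del: ell_simps)
qed

lemma conjugate_exponent:
  assumes "1 < (p::real)"
  obtains q where "1 < q" "1 / p + 1 / q = 1" "1 / q = 1 - 1 / p"
  using assms by (intro that[of "1 / (1 - 1 / p)"]) (auto simp: field_simps)

text \<open>\<open>no_domination_on_large_level\<close> covers all large levels, and the infinite
  set \<open>N\<close> contains one of them. The line obtained there has no partner on any other
  level under any of the forms.\<close>

lemma level_without_domination:
  fixes c C :: real
  assumes "1 < a" "1 < b" "1 / a + 1 / b = 1" "0 \<le> C" "0 < c"
    and "finite \<B>" "\<And>\<beta>. \<beta> \<in> \<B> \<Longrightarrow> form_bound a b C \<beta>" and inf: "infinite N"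
  shows "\<exists>n\<in>N. \<exists>t\<in>lines n. \<forall>\<beta>\<in>\<B>. \<forall>t'. fst t' \<noteq> n \<longrightarrow> t' \<in> lines (fst t') \<longrightarrow>
    \<bar>\<Sum>i\<in>line t. \<Sum>j\<in>line t'. \<beta> i j\<bar> < c * (side (fst t) powr (1 / a) * side (fst t') powr (1 / b))"
proof -
  define dom where "dom n t \<longleftrightarrow> (\<exists>\<beta>\<in>\<B>. \<exists>m. m \<noteq> n \<and> (\<exists>t'\<in>lines m.
    c * side n powr (1 / a) * side m powr (1 / b) \<le> \<bar>\<Sum>i\<in>line t. \<Sum>j\<in>line t'. \<beta> i j\<bar>))" for n t
  have "\<exists>\<^sub>F n in sequentially. n \<in> N"
    using inf by (simp add: cofinite_eq_sequentially[symmetric] INFM_iff_infinite)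
  moreover have "\<forall>\<^sub>F n in sequentially. \<not> (\<forall>t\<in>lines n. dom n t)"
    unfolding dom_def by (rule no_domination_on_large_level[OF assms(1-7)])
  ultimately have "\<exists>\<^sub>F n in sequentially. \<not> (\<forall>t\<in>lines n. dom n t) \<and> n \<in> N"
    by (rule frequently_eventually_conj)
  then obtain n t where n: "n \<in> N" and t: "t \<in> lines n" "\<not> dom n t"
    by (auto dest!: frequently_ex)
  show ?thesis
  proof (intro bexI[OF _ n] bexI[OF _ t(1)] ballI allI impI)
    fix \<beta> t' assume "\<beta> \<in> \<B>" "fst t' \<noteq> n" "t' \<in> lines (fst t')"
    with t(2)[unfolded dom_def] have "\<not> c * side n powr (1 / a) * side (fst t') powr (1 / b) \<le>
      \<bar>\<Sum>i\<in>line t. \<Sum>j\<in>line t'. \<beta> i j\<bar>" by blast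
    then show "\<bar>\<Sum>i\<in>line t. \<Sum>j\<in>line t'. \<beta> i j\<bar> < c * (side (fst t) powr (1 / a) * side (fst t') powr (1 / b))"
      using fst_lines[OF t(1)] by (simp add: mult.assoc)
  qed
qed

text \<open>The test vector is the bump of a line \<open>t\<close> without partners, on a level in
  \<open>M - M'\<close>. Coordinate \<open>to_nat t\<close> of its image is 1, so with error
  \<open>1 / 2\<close> the constant \<open>K\<close> times some pairing with a line of
  \<open>M'\<close> would be at least \<open>1 / 2\<close>; but every such pairing is below
  \<open>c\<close>.\<close>

lemma avg_op_not_dominated:
  assumes p: "1 < p" and inf: "infinite (M - M')"
  shows "avg_op p M \<notin> dominated p M'"
proof
  assume dom: "avg_op p M \<in> dominated p M'"
  obtain K \<B> where K: "0 \<le> K" "finite \<B>" "\<B> \<subseteq> operators (ell p) (ell p)"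
    "\<And>x. x \<in> vecs (ell p) \<Longrightarrow> \<exists>B\<in>\<B>. \<exists>t\<in>lines_of M'.
      \<forall>i. \<bar>avg_op p M x i\<bar> \<le> K * \<bar>line_avg p t (B x)\<bar> + 1 / 2 * nrm (ell p) x"
    using dominatedD[OF dom half_gt_zero[OF zero_less_one]] by metis
  obtain q where q: "1 < q" "1 / p + 1 / q = 1" "1 / q = 1 - 1 / p" using conjugate_exponent[OF p] by blast
  obtain C where C: "0 \<le> C" "\<And>B. B \<in> \<B> \<Longrightarrow> form_bound p q C (\<lambda>i j. B (unit_vec i) j)"
    using uniform_form_bound[OF p q(1,2) K(2,3)] by blast
  \<comment> \<open>\<open>K + 1\<close> instead of \<open>K\<close> covers \<open>K = 0\<close> and
    makes \<open>K * c < 1 / 2\<close> strict.\<close>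
  define c where "c = 1 / (2 * (K + 1))"
  have c: "0 < c" "K * c < 1 / 2" using K(1) by (auto simp: c_def field_simps)
  define \<F> where "\<F> = (\<lambda>B i j. B (unit_vec i) j) ` \<B>"
  have fb: "finite \<F>" "\<And>\<beta>. \<beta> \<in> \<F> \<Longrightarrow> form_bound p q C \<beta>"
    using K(2) C(2) by (auto simp: \<F>_def)
  obtain n t where n: "n \<in> M - M'" and t: "t \<in> lines n" and small:
    "\<forall>\<beta>\<in>\<F>. \<forall>t'. fst t' \<noteq> n \<longrightarrow> t' \<in> lines (fst t') \<longrightarrow>
      \<bar>\<Sum>i\<in>line t. \<Sum>j\<in>line t'. \<beta> i j\<bar> < c * (side (fst t) powr (1 / p) * side (fst t') powr (1 / q))"
    using level_without_domination[OF p q(1,2) C(1) c(1) fb inf] by blast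
  obtain B t' where B: "B \<in> \<B>" "t' \<in> lines_of M'"
    "\<And>i. \<bar>avg_op p M (bump p t) i\<bar> \<le> K * \<bar>line_avg p t' (B (bump p t))\<bar> + 1 / 2 * nrm (ell p) (bump p t)"
    using K(4)[OF bump_in[of p t]] by blast
  have t': "fst t' \<noteq> n" "t' \<in> lines (fst t')" using B(2) n by (auto simp: lines_of_iff)
  have "t \<in> lines_of M" using t n fst_lines[OF t] by (simp add: lines_of_iff)
  then have "avg_op p M (bump p t) (to_nat t) = 1"
    using bump_in[of p t] by (simp add: avg_op_def line_avg_bump del: ell_simps)
  then have half: "1 / 2 \<le> K * \<bar>line_avg p t' (B (bump p t))\<bar>"
    using B(3)[of "to_nat t"] nrm_bump[of p t] p by (simp del: ell_simps)
  have pos: "0 < side (fst t) powr (1 / p) * side (fst t') powr (1 / q)"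
    using side_pos by simp
  have "\<bar>line_avg p t' (B (bump p t))\<bar> * (side (fst t) powr (1 / p) * side (fst t') powr (1 / q)) =
      \<bar>\<Sum>i\<in>line t. \<Sum>j\<in>line t'. B (unit_vec i) j\<bar>"
    using line_avg_operator_bump[OF p subsetD[OF K(3) B(1)], of t' t, symmetric] unfolding q(3)
    by (simp add: abs_mult)
  also have "\<dots> < c * (side (fst t) powr (1 / p) * side (fst t') powr (1 / q))"
    using B(1) t' by (intro small[rule_format]) (auto simp: \<F>_def)
  finally have "\<bar>line_avg p t' (B (bump p t))\<bar> < c"
    using pos by (rule mult_right_less_imp_less[OF _ less_imp_le])
  then have "K * \<bar>line_avg p t' (B (bump p t))\<bar> \<le> K * c" using K(1) by (intro mult_left_mono) auto
  with half c show False by linarith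
qed

section \<open>Operators with bumps as columns: membership and separation\<close>

definition bump_sum :: "real \<Rightarrow> nat set \<Rightarrow> (nat \<Rightarrow> real) \<Rightarrow> nat \<Rightarrow> real" where
  "bump_sum p M z i =
     (\<Sum>t\<in>lines (fst (prod_decode i)) \<inter> lines_of M. z (to_nat t) * bump p t i)"

lemma level_of_line: "i \<in> line t \<Longrightarrow> fst (prod_decode i) = fst t"
  by (cases t) (auto simp: line_def)

text \<open>A point lies only on lines of its own level, so the sum in \<open>bump_sum\<close> is
  finite for every \<open>z\<close> and further lines add zero. One finite \<open>G\<close> can then
  serve all points of a finite set, as Minkowski requires.\<close>

lemma bump_sum_eq:
  assumes "finite G" "G \<subseteq> lines_of M" "lines (fst (prod_decode i)) \<inter> lines_of M \<subseteq> G"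
  shows "bump_sum p M z i = (\<Sum>t\<in>G. z (to_nat t) * bump p t i)"
  unfolding bump_sum_def
proof (rule sum.mono_neutral_left[OF assms(1,3)], rule ballI)
  fix t assume "t \<in> G - lines (fst (prod_decode i)) \<inter> lines_of M"
  then have "t \<in> lines (fst t)" "t \<notin> lines (fst (prod_decode i))" using assms(2) by (auto simp: lines_of_iff)
  then have "i \<notin> line t" using level_of_line[of i t] by auto
  then show "z (to_nat t) * bump p t i = 0" by (simp add: bump_def cut_def)
qed

lemma ell_1:
  assumes "z \<in> vecs (ell 1)"
  shows "summable (\<lambda>n. \<bar>z n\<bar>)" "nrm (ell 1) z = (\<Sum>n. \<bar>z n\<bar>)"
  using assms by (auto simp: suminf_nonneg)

text \<open>The triangle inequality over the finitely many lines on the levels met by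
  \<open>E\<close>, all bumps having norm one. Since \<open>to_nat\<close> is injective, their
  coefficients are distinct coordinates of \<open>z\<close>.\<close>

lemma lpn_bump_sum_le:
  assumes p: "1 < p" and z: "z \<in> vecs (ell 1)" and E: "finite E"
  shows "lpn p E (bump_sum p M z) \<le> nrm (ell 1) z"
proof -
  obtain q where q: "1 < q" "1 / p + 1 / q = 1" "1 / q = 1 - 1 / p" using conjugate_exponent[OF p] by blast
  define G where "G = (\<Union>i\<in>E. lines (fst (prod_decode i)) \<inter> lines_of M)"
  have G: "finite G" "G \<subseteq> lines_of M" using E finite_lines by (auto simp: G_def)
  have "lpn p E (bump_sum p M z) = lpn p E (\<lambda>i. \<Sum>t\<in>G. z (to_nat t) * bump p t i)"
  proof -
    have "bump_sum p M z i = (\<Sum>t\<in>G. z (to_nat t) * bump p t i)" if "i \<in> E" for i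
      by (rule bump_sum_eq[OF G]) (use that in \<open>auto simp: G_def\<close>)
    then show ?thesis by (simp add: lpn_def)
  qed
  also have "\<dots> \<le> (\<Sum>t\<in>G. \<bar>z (to_nat t)\<bar> * lpn p E (bump p t))"
    by (rule Minkowski_sum[OF p q(1,2) E])
  also have "\<dots> \<le> (\<Sum>t\<in>G. \<bar>z (to_nat t)\<bar> * 1)"
    using lpn_le_nrm[OF _ bump_in E, of p] nrm_bump[of p] p
    by (intro sum_mono mult_left_mono) (simp_all del: ell_simps)
  also have "\<dots> = (\<Sum>j\<in>to_nat ` G. \<bar>z j\<bar>)"
    by (subst sum.reindex) (auto simp: inj_on_def)
  also have "\<dots> \<le> nrm (ell 1) z"
    unfolding ell_1(2)[OF z] using G by (intro sum_le_suminf ell_1(1)[OF z]) auto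
  finally show ?thesis .
qed

lemma ell_bounded_partial_norms:
  assumes p: "0 < p" and N: "0 \<le> N" and le: "\<And>E. finite E \<Longrightarrow> lpn p E x \<le> N"
  shows "x \<in> vecs (ell p)" "nrm (ell p) x \<le> N"
proof -
  have le': "(\<Sum>i<n. \<bar>x i\<bar> powr p) \<le> N powr p" for n
    using powr_mono2[OF less_imp_le[OF p] lpn_nonneg le[of "{..<n}"]] p by (simp add: lpn_powr)
  have s: "summable (\<lambda>i. \<bar>x i\<bar> powr p)"
    by (rule summableI_nonneg_bounded[OF _ le']) simp
  then show "x \<in> vecs (ell p)" by simp
  have "(\<Sum>i. \<bar>x i\<bar> powr p) \<le> N powr p" by (rule suminf_le_const[OF s le'])
  then have "(\<Sum>i. \<bar>x i\<bar> powr p) powr (1 / p) \<le> (N powr p) powr (1 / p)"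
    using p s by (intro powr_mono2) (auto simp: suminf_nonneg)
  then show "nrm (ell p) x \<le> N" using p N by (simp add: powr_powr)
qed

definition bump_op :: "real \<Rightarrow> nat set \<Rightarrow> (nat \<Rightarrow> real) \<Rightarrow> nat \<Rightarrow> real" where
  "bump_op p M = restrict (bump_sum p M) (vecs (ell 1))"

lemma bump_op_in:
  assumes p: "1 < p"
  shows "bump_op p M \<in> operators (ell 1) (ell p)"
  unfolding bump_op_def
proof (intro restrict_operatorI[where C = 1])
  fix z assume z: "z \<in> vecs (ell 1)"
  have nn: "0 \<le> nrm (ell 1) z" by (simp only: ell_simps powr_ge_zero)
  note * = ell_bounded_partial_norms[OF _ nn lpn_bump_sum_le[OF p z], of M]
  show "bump_sum p M z \<in> vecs (ell p)" "nrm (ell p) (bump_sum p M z) \<le> 1 * nrm (ell 1) z"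
    using * p by (simp_all only: mult_1)
qed (auto simp: bump_sum_def fun_eq_iff sum.distrib sum_distrib_left algebra_simps quasinormed_ell)

lemma bump_op_unit_vec:
  "bump_op p M (unit_vec j) = (if j \<in> to_nat ` lines_of M then bump p (from_nat j) else (\<lambda>_. 0))"
proof -
  have u: "unit_vec j \<in> vecs (ell 1)" by (rule unit_vec_in)
  have "bump_sum p M (unit_vec j) i = (if j \<in> to_nat ` lines_of M then bump p (from_nat j) i else 0)" for i
  proof (cases "j \<in> to_nat ` lines_of M")
    case True
    then obtain t where t: "t \<in> lines_of M" "j = to_nat t" by auto
    \<comment> \<open>Inserting \<open>t\<close> covers the points \<open>i\<close> of other levels,
      where its bump is zero.\<close>
    have "bump_sum p M (unit_vec j) i =
      (\<Sum>t'\<in>insert t (lines (fst (prod_decode i)) \<inter> lines_of M). unit_vec j (to_nat t') * bump p t' i)"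
      using t finite_lines by (intro bump_sum_eq) auto
    also have "\<dots> = (\<Sum>t'\<in>insert t (lines (fst (prod_decode i)) \<inter> lines_of M). if t' = t then bump p t i else 0)"
      by (intro sum.cong refl) (auto simp: unit_vec_def t(2))
    also have "\<dots> = bump p t i" using finite_lines by simp
    finally show ?thesis using True t by simp
  next
    case False
    then have "unit_vec j (to_nat t) = 0" if "t \<in> lines_of M" for t
      using that by (auto simp: unit_vec_def)
    then show ?thesis using False by (simp add: bump_sum_def)
  qed
  then show ?thesis using u by (auto simp: bump_op_def fun_eq_iff simp del: ell_simps)
qed

text \<open>The norm of a functional on \<open>ell 1\<close> is its supremum over the unit vectors:
  finite sections obey the bound \<open>s\<close>, and continuity with the constant \<open>b\<close>
  makes the tail vanish in the limit.\<close>

lemma ell_1_functional_le: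
  fixes u :: "(nat \<Rightarrow> real) \<Rightarrow> real"
  assumes add: "\<And>x y. x \<in> vecs (ell 1) \<Longrightarrow> y \<in> vecs (ell 1) \<Longrightarrow> u (\<lambda>n. x n + y n) = u x + u y"
    and scale: "\<And>c x. x \<in> vecs (ell 1) \<Longrightarrow> u (\<lambda>n. c * x n) = c * u x"
    and bound: "\<And>x. x \<in> vecs (ell 1) \<Longrightarrow> \<bar>u x\<bar> \<le> b * nrm (ell 1) x"
    and unit: "\<And>j. \<bar>u (unit_vec j)\<bar> \<le> s" and z: "z \<in> vecs (ell 1)"
  shows "\<bar>u z\<bar> \<le> s * nrm (ell 1) z"
proof -
  have q: "quasinormed (ell 1)" by (rule quasinormed_ell) simp
  interpret quasinormed "ell 1" by (rule q)
  have s: "0 \<le> s" using unit[of 0] by linarith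
  define tail where "tail k = (\<lambda>n. z n + - 1 * cut {..<k} z n)" for k
  have cutk: "cut {..<k} z \<in> vecs (ell 1)" for k by (intro nrm_cut) simp
  have tail_in: "tail k \<in> vecs (ell 1)" for k
    unfolding tail_def by (intro add_in scale_in z cutk)
  have nrm_tail: "nrm (ell 1) (tail k) = (\<Sum>n. \<bar>z n\<bar>) - (\<Sum>n<k. \<bar>z n\<bar>)" for k
  proof -
    have 1: "(\<lambda>n. \<bar>cut {..<k} z n\<bar>) sums (\<Sum>n<k. \<bar>cut {..<k} z n\<bar>)"
      by (intro sums_finite) (auto simp: cut_def)
    have "(\<lambda>n. \<bar>z n\<bar> - \<bar>cut {..<k} z n\<bar>) sums ((\<Sum>n. \<bar>z n\<bar>) - (\<Sum>n<k. \<bar>cut {..<k} z n\<bar>))"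
      by (intro sums_diff 1 summable_sums ell_1(1) z)
    moreover have "(\<lambda>n. \<bar>z n\<bar> - \<bar>cut {..<k} z n\<bar>) = (\<lambda>n. \<bar>tail k n\<bar>)"
      by (auto simp: tail_def cut_def)
    moreover have "(\<Sum>n<k. \<bar>cut {..<k} z n\<bar>) = (\<Sum>n<k. \<bar>z n\<bar>)"
      by (intro sum.cong) (auto simp: cut_def)
    ultimately show ?thesis unfolding ell_1(2)[OF tail_in] by (simp add: sums_iff)
  qed
  have est: "\<bar>u z\<bar> \<le> s * nrm (ell 1) z + b * ((\<Sum>n. \<bar>z n\<bar>) - (\<Sum>n<k. \<bar>z n\<bar>))" for k
  proof -
    have "z = (\<lambda>n. cut {..<k} z n + tail k n)" by (auto simp: tail_def)
    then have "u z = u (cut {..<k} z) + u (tail k)"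
      using add[OF cutk tail_in, of k k] by simp
    moreover have "\<bar>u (tail k)\<bar> \<le> b * ((\<Sum>n. \<bar>z n\<bar>) - (\<Sum>n<k. \<bar>z n\<bar>))"
      using bound[OF tail_in, of k] unfolding nrm_tail .
    moreover have "\<bar>u (cut {..<k} z)\<bar> \<le> s * nrm (ell 1) z"
    proof -
      have "u (cut {..<k} z) = (\<Sum>j<k. z j * u (unit_vec j))"
        by (rule linear_cut[OF q unit_vec_in _ add scale]) simp_all
      also have "\<bar>\<dots>\<bar> \<le> (\<Sum>j<k. \<bar>z j\<bar> * s)"
        using unit by (intro order.trans[OF sum_abs] sum_mono) (simp add: abs_mult mult_left_mono)
      also have "\<dots> = s * (\<Sum>j<k. \<bar>z j\<bar>)" by (simp add: sum_distrib_left mult.commute)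
      also have "\<dots> \<le> s * (\<Sum>j. \<bar>z j\<bar>)"
        by (intro mult_left_mono s sum_le_suminf ell_1(1)[OF z]) auto
      finally show ?thesis by (simp only: ell_1(2)[OF z])
    qed
    ultimately show ?thesis by linarith
  qed
  have "(\<lambda>k. s * nrm (ell 1) z + b * ((\<Sum>n. \<bar>z n\<bar>) - (\<Sum>n<k. \<bar>z n\<bar>))) \<longlonglongrightarrow>
      s * nrm (ell 1) z + b * ((\<Sum>n. \<bar>z n\<bar>) - (\<Sum>n. \<bar>z n\<bar>))"
    by (intro tendsto_intros summable_LIMSEQ ell_1(1)[OF z])
  then show ?thesis
    using est by (intro LIMSEQ_le_const[of _ "s * nrm (ell 1) z"]) (auto simp del: ell_simps)
qed

text \<open>Again the identity with \<open>K = 1\<close>, and a line where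
  \<open>\<bar>y (bump p t)\<bar>\<close> is maximal up to the error.
  \<open>ell_1_functional_le\<close> reduces all \<open>z\<close> to unit vectors, whose images are
  bumps or zero.\<close>

lemma bump_op_codominated:
  assumes p: "1 < p" and M: "M \<noteq> {}"
  shows "bump_op p M \<in> codominated p M"
proof -
  have q: "quasinormed (ell p)" using p by (intro quasinormed_ell) auto
  note op = bump_op_in[OF p, of M]
  define I where "I = (\<lambda>x\<in>vecs (ell p). x)"
  have I: "I \<in> operators (ell p) (ell p)" unfolding I_def by (rule op_id_in[OF q])
  obtain D where D: "0 < D" "\<And>z. z \<in> vecs (ell 1) \<Longrightarrow> nrm (ell p) (bump_op p M z) \<le> D * nrm (ell 1) z"
    using operators_bound[OF op quasinormed_ell] by auto
  have "\<exists>t\<in>lines_of M. \<forall>z\<in>vecs (ell 1).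
      \<bar>y (bump_op p M z)\<bar> \<le> (1 * \<bar>y (I (bump p t))\<bar> + \<epsilon> * b) * nrm (ell 1) z"
    if \<epsilon>: "0 < \<epsilon>" and y: "y \<in> functionals p b" for \<epsilon> y b
  proof -
    note yD = functionalsD[OF y]
    have "\<bar>y (bump p t)\<bar> \<le> b" for t
      using yD(4)[OF bump_in[of p t]] nrm_bump[of p t] p by (simp del: ell_simps)
    then obtain t where t: "t \<in> lines_of M"
      "\<And>t'. t' \<in> lines_of M \<Longrightarrow> \<bar>y (bump p t')\<bar> \<le> \<bar>y (bump p t)\<bar> + \<epsilon> * b"
      using almost_max[OF lines_of_nonempty[OF M], of "\<lambda>t. y (bump p t)" b \<epsilon>] \<epsilon> by blast
    have y0: "y (\<lambda>_. 0) = 0" using yD(3)[OF quasinormed.zero_in[OF q], of 0] by simp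
    have "\<bar>y (bump_op p M z)\<bar> \<le> (\<bar>y (bump p t)\<bar> + \<epsilon> * b) * nrm (ell 1) z"
      if z: "z \<in> vecs (ell 1)" for z
    proof (rule ell_1_functional_le[where u = "\<lambda>z. y (bump_op p M z)" and b = "b * D", OF _ _ _ _ z])
      fix w assume w: "w \<in> vecs (ell 1)"
      note Ow = operators_in[OF op w]
      show "y (bump_op p M (\<lambda>n. c * w n)) = c * y (bump_op p M w)" for c
        by (simp only: operators_scale[OF op w] yD(3)[OF Ow])
      show "y (bump_op p M (\<lambda>n. w n + w' n)) = y (bump_op p M w) + y (bump_op p M w')"
        if w': "w' \<in> vecs (ell 1)" for w'
        by (simp only: operators_add[OF op w w'] yD(2)[OF Ow operators_in[OF op w']])
      have "\<bar>y (bump_op p M w)\<bar> \<le> b * nrm (ell p) (bump_op p M w)" by (rule yD(4)[OF Ow])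
      also have "\<dots> \<le> b * (D * nrm (ell 1) w)" by (intro mult_left_mono D(2) w yD(1))
      finally show "\<bar>y (bump_op p M w)\<bar> \<le> b * D * nrm (ell 1) w" by (simp only: mult.assoc)
    next
      fix j
      show "\<bar>y (bump_op p M (unit_vec j))\<bar> \<le> \<bar>y (bump p t)\<bar> + \<epsilon> * b"
        using t(2) \<epsilon> yD(1) y0 by (auto simp: bump_op_unit_vec)
    qed
    then show ?thesis using t(1) bump_in[of p t]
      by (intro bexI[of _ t]) (simp_all add: I_def del: ell_simps)
  qed
  then show ?thesis unfolding codominated_def using op I
    by (intro CollectI conjI allI impI exI[of _ 1] exI[of _ "{I}"] ballI bexI[of _ I]) (simp_all del: ell_simps)
qed

text \<open>Dual to \<open>avg_op_not_dominated\<close>: the test functional is the average over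
  \<open>t\<close>, with value 1 on the column of \<open>t\<close>. Now \<open>t\<close> sits on the
  output side of the matrix, so the transposed forms with exponents \<open>q\<close> and
  \<open>p\<close> are counted.\<close>

lemma bump_op_not_codominated:
  assumes p: "1 < p" and inf: "infinite (M - M')"
  shows "bump_op p M \<notin> codominated p M'"
proof
  assume dom: "bump_op p M \<in> codominated p M'"
  obtain K \<B> where K: "0 \<le> K" "finite \<B>" "\<B> \<subseteq> operators (ell p) (ell p)"
    "\<And>b y. y \<in> functionals p b \<Longrightarrow> \<exists>B\<in>\<B>. \<exists>t\<in>lines_of M'. \<forall>z\<in>vecs (ell 1).
      \<bar>y (bump_op p M z)\<bar> \<le> (K * \<bar>y (B (bump p t))\<bar> + 1 / 2 * b) * nrm (ell 1) z"
    using codominatedD[OF dom half_gt_zero[OF zero_less_one]] by metis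
  obtain q where q: "1 < q" "1 / p + 1 / q = 1" "1 / q = 1 - 1 / p" using conjugate_exponent[OF p] by blast
  then have q': "1 / q + 1 / p = 1" by simp
  obtain C where C: "0 \<le> C" "\<And>B. B \<in> \<B> \<Longrightarrow> form_bound q p C (\<lambda>j i. B (unit_vec i) j)"
    using uniform_form_bound[OF p q(1,2) K(2,3)] by blast
  define c where "c = 1 / (2 * (K + 1))"
  have c: "0 < c" "K * c < 1 / 2" using K(1) by (auto simp: c_def field_simps)
  define \<F> where "\<F> = (\<lambda>B j i. B (unit_vec i) j) ` \<B>"
  have fb: "finite \<F>" "\<And>\<beta>. \<beta> \<in> \<F> \<Longrightarrow> form_bound q p C \<beta>"
    using K(2) C(2) by (auto simp: \<F>_def)
  obtain n t where n: "n \<in> M - M'" and t: "t \<in> lines n" and small: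
    "\<forall>\<beta>\<in>\<F>. \<forall>t'. fst t' \<noteq> n \<longrightarrow> t' \<in> lines (fst t') \<longrightarrow>
      \<bar>\<Sum>j\<in>line t. \<Sum>i\<in>line t'. \<beta> j i\<bar> < c * (side (fst t) powr (1 / q) * side (fst t') powr (1 / p))"
    using level_without_domination[OF q(1) p q' C(1) c(1) fb inf] by blast
  have y: "line_avg p t \<in> functionals p 1"
    unfolding functionals_def
    using abs_line_avg_le[OF p] by (auto simp: line_avg_add line_avg_scale simp del: ell_simps)
  obtain B t' where B: "B \<in> \<B>" "t' \<in> lines_of M'"
    "\<And>z. z \<in> vecs (ell 1) \<Longrightarrow> \<bar>line_avg p t (bump_op p M z)\<bar> \<le>
      (K * \<bar>line_avg p t (B (bump p t'))\<bar> + 1 / 2 * 1) * nrm (ell 1) z"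
    using K(4)[OF y] by blast
  have t': "fst t' \<noteq> n" "t' \<in> lines (fst t')" using B(2) n by (auto simp: lines_of_iff)
  have "t \<in> lines_of M" using t n fst_lines[OF t] by (simp add: lines_of_iff)
  then have "line_avg p t (bump_op p M (unit_vec (to_nat t))) = 1"
    by (simp add: bump_op_unit_vec line_avg_bump)
  then have half: "1 / 2 \<le> K * \<bar>line_avg p t (B (bump p t'))\<bar>"
    using B(3)[OF unit_vec_in[of "to_nat t"]] by (simp only: nrm_unit_vec) simp
  have pos: "0 < side (fst t) powr (1 / q) * side (fst t') powr (1 / p)"
    using side_pos by simp
  have "\<bar>line_avg p t (B (bump p t'))\<bar> * (side (fst t) powr (1 / q) * side (fst t') powr (1 / p)) =
      \<bar>\<Sum>i\<in>line t'. \<Sum>j\<in>line t. B (unit_vec i) j\<bar>"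
    using line_avg_operator_bump[OF p subsetD[OF K(3) B(1)], of t t', symmetric] unfolding q(3)
    by (simp add: abs_mult mult.commute)
  also have "\<dots> = \<bar>\<Sum>j\<in>line t. \<Sum>i\<in>line t'. B (unit_vec i) j\<bar>"
    by (subst sum.swap) (rule refl)
  also have "\<dots> < c * (side (fst t) powr (1 / q) * side (fst t') powr (1 / p))"
    using B(1) t' by (intro small[rule_format, of "\<lambda>j i. B (unit_vec i) j"]) (auto simp: \<F>_def)
  finally have "\<bar>line_avg p t (B (bump p t'))\<bar> < c"
    using pos by (rule mult_right_less_imp_less[OF _ less_imp_le])
  then have "K * \<bar>line_avg p t (B (bump p t'))\<bar> \<le> K * c" using K(1) by (intro mult_left_mono) auto
  with half c show False by linarith
qed

text \<open>An almost disjoint family of infinite sets of levels, indexed by the reals.\<close>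

definition branch :: "real \<Rightarrow> nat set" where
  "branch r = range (\<lambda>n::nat. to_nat (n, \<lfloor>r * 2 ^ n\<rfloor>))"

text \<open>The integer parts of \<open>r * 2 ^ n\<close> and \<open>s * 2 ^ n\<close> differ once
  \<open>\<bar>r - s\<bar> * 2 ^ n\<close> exceeds 1. The coded pair contains \<open>n\<close>, so
  these codes are pairwise distinct and lie outside the other branch.\<close>

lemma infinite_branch_Diff:
  assumes "r \<noteq> s"
  shows "infinite (branch r - branch s)"
proof -
  have "\<forall>\<^sub>F n in sequentially. 1 < \<bar>r - s\<bar> * 2 ^ n"
    using assms by real_asymp
  then obtain N where N: "\<And>n. N \<le> n \<Longrightarrow> 1 < \<bar>r - s\<bar> * 2 ^ n" by (auto simp: eventually_sequentially)
  have ne: "\<lfloor>r * 2 ^ n\<rfloor> \<noteq> \<lfloor>s * 2 ^ n\<rfloor>" if "N \<le> n" for n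
  proof
    assume "\<lfloor>r * 2 ^ n\<rfloor> = \<lfloor>s * 2 ^ n\<rfloor>"
    then have "\<bar>r * 2 ^ n - s * 2 ^ n\<bar> < 1" by linarith
    moreover have "\<bar>r * 2 ^ n - s * 2 ^ n\<bar> = \<bar>r - s\<bar> * 2 ^ n"
      by (simp add: abs_mult flip: left_diff_distrib)
    ultimately show False using N[OF that] by simp
  qed
  have "(\<lambda>n. to_nat (n, \<lfloor>r * 2 ^ n\<rfloor>)) ` {N..} \<subseteq> branch r - branch s"
    using ne by (auto simp: branch_def)
  moreover have "infinite ((\<lambda>n. to_nat (n, \<lfloor>r * 2 ^ n\<rfloor>)) ` {N..})"
    by (subst finite_image_iff) (auto simp: inj_on_def infinite_Ici)
  ultimately show ?thesis using infinite_super by blast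
qed

text \<open>\<open>T (branch r)\<close> lies in the ideal of \<open>branch r\<close> and in that of
  no other branch, so the ideal determines \<open>r\<close>.\<close>

lemma continuum_many_closed_idealsI:
  assumes "\<And>r. closed_operator_ideal X Y (J (branch r))"
    and "\<And>r. T (branch r) \<in> J (branch r)"
    and "\<And>r s. infinite (branch r - branch s) \<Longrightarrow> T (branch r) \<notin> J (branch s)"
  shows "continuum_many_closed_ideals X Y"
proof -
  have "inj (\<lambda>r. J (branch r))"
  proof (rule injI, rule ccontr)
    fix r s assume "J (branch r) = J (branch s)" "r \<noteq> s"
    then show False using assms(2)[of r] assms(3)[OF infinite_branch_Diff, of r s] by simp
  qed
  then have "range (\<lambda>r. J (branch r)) \<approx> (UNIV :: real set)"
    by (rule inj_on_image_eqpoll_self)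
  then show ?thesis
    unfolding continuum_many_closed_ideals_def
    by (intro exI[of _ "range (\<lambda>r. J (branch r))"] conjI) (auto intro: assms(1))
qed

theorem theorem2:
  fixes p :: real
  assumes "1 < p"
  shows "continuum_many_closed_ideals (ell p) ell_infinity \<and>
         continuum_many_closed_ideals (ell 1) (ell p)"
proof
  have ne: "branch r \<noteq> {}" for r by (simp add: branch_def)
  show "continuum_many_closed_ideals (ell p) ell_infinity"
    by (rule continuum_many_closed_idealsI[where J = "dominated p" and T = "avg_op p",
          OF closed_ideal_dominated[OF assms ne]
          avg_op_dominated[OF assms ne] avg_op_not_dominated[OF assms]])
  show "continuum_many_closed_ideals (ell 1) (ell p)"
    by (rule continuum_many_closed_idealsI[where J = "codominated p" and T = "bump_op p",
          OF closed_ideal_codominated[OF assms ne]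
          bump_op_codominated[OF assms ne] bump_op_not_codominated[OF assms]])
qed

end
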